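(* Let $E$ be a Polish space, $\mu\in\mathcal{P}(E)$, and let $c:E^2\to[0,\infty]$ be lower semicontinuous, not identically $\infty$, with $\int_E c(x,x)\,\mu(dx)<\infty$. Suppose that for each compact set $K\subset E$ the function $h_K(y):=\inf_{x\in K}c(x,y)$ has pre-compact sub-level sets, i.e. the closure of $\{y\in E:h_K(y)\le m\}$ is compact for each $m\ge0$. Let $\alpha(\nu)=\inf_{\pi\in\Pi(\mu,\nu)}\int c\,d\pi$ for $\nu\in\mathcal{P}(E)$. Let $(X_i)_{i=1}^\infty$ be i.i.d. $E$-valued random variables with law $\mu$ on some probability space, and for each $n$ let $\mathcal{Y}_n$ be the set of $E^n$-valued random variables $(Y_1,\dots,Y_n)$ on that space such that $Y_k$ is $(X_1,\dots,X_k)$-measurable for each $k=1,\dots,n$. Then, for each bounded continuous $F:\mathcal{P}(E)\to\mathbb{R}$, $$\lim_{n\to\infty}\sup_{(Y_k)_{k=1}^n\in\mathcal{Y}_n}\mathbb{E}\Big[F(L_n(Y_1,\dots,Y_n))-\frac1n\sum_{i=1}^nc(X_i,Y_i)\Big]=\sup_{\nu\in\mathcal{P}(E)}\big(F(\nu)-\alpha(\nu)\big)=\sup_{\pi\in\Pi(\mu)}\Big(F(\pi(E\times\cdot))-\int_{E\times E}c\,d\pi\Big),$$ where $\Pi(\mu)=\bigcup_{\nu\in\mathcal{P}(E)}\Pi(\mu,\nu)$.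
   Context: $\mathcal{P}(E)$ is the set of Borel probability measures on $E$ with the topology of weak convergence. $\Pi(\mu,\nu)$ is the set of probability measures on $E\times E$ with first marginal $\mu$ and second marginal $\nu$; $\pi(E\times\cdot)$ is the second marginal of $\pi$. $L_n(y_1,\dots,y_n)=\frac1n\sum_{i=1}^n\delta_{y_i}$. *)

theory Defs
  imports "HOL-Probability.Probability"
begin

abbreviation borel_probs :: "'a::topological_space measure set" where
  "borel_probs \<equiv> space (prob_algebra borel)"

text \<open>The coarsest topology on the Borel probability measures for which integration of each
  bounded continuous real function is continuous.\<close>

definition weak_topology :: "'a::topological_space measure topology" where
  "weak_topology = topology_generated_by
     {{\<nu> \<in> borel_probs. (LINT x|\<nu>. f x) \<in> U} | f U.
        continuous_on UNIV f \<and> bounded (range f) \<and> open (U :: real set)}"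

lemma topspace_weak_topology: "topspace weak_topology = borel_probs"
proof -
  have "borel_probs \<in> {{\<nu> \<in> borel_probs. (LINT x|\<nu>. f x) \<in> U} | f U.
        continuous_on UNIV f \<and> bounded (range f) \<and> open (U :: real set)}"
    by (intro CollectI exI[of _ "\<lambda>_. 0"] exI[of _ UNIV]) auto
  then show ?thesis
    unfolding weak_topology_def topology_generated_by_topspace by blast
qed

definition lower_semicontinuous :: "('a::topological_space \<Rightarrow> ennreal) \<Rightarrow> bool" where
  "lower_semicontinuous f \<longleftrightarrow> (\<forall>a. open {x. a < f x})"

text \<open>Since \<open>borel\<close> on the product type is generated by the product topology, for a second
  countable space it agrees with the product sigma-algebra.\<close>

definition couplings ::
    "'a::topological_space measure \<Rightarrow> 'a measure \<Rightarrow> ('a \<times> 'a) measure set" where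
  "couplings \<mu> \<nu> = {\<pi> \<in> borel_probs. distr \<pi> borel fst = \<mu> \<and> distr \<pi> borel snd = \<nu>}"

definition transport_cost ::
    "('a::topological_space \<times> 'a \<Rightarrow> ennreal) \<Rightarrow> 'a measure \<Rightarrow> 'a measure \<Rightarrow> ennreal" where
  "transport_cost c \<mu> \<nu> = (INF \<pi>\<in>couplings \<mu> \<nu>. \<integral>\<^sup>+ p. c p \<partial>\<pi>)"

text \<open>\<open>(1/n) (\<delta>\<^bsub>y 1\<^esub> + \<dots> + \<delta>\<^bsub>y n\<^esub>)\<close>; a probability measure only for \<open>n \<ge> 1\<close>.\<close>

definition empirical :: "nat \<Rightarrow> (nat \<Rightarrow> 'a::topological_space) \<Rightarrow> 'a measure" where
  "empirical n y = measure_of UNIV (sets borel)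
     (\<lambda>A. ennreal (1 / real n) * (\<Sum>i = 1..n. emeasure (return borel (y i)) A))"

lemma sets_empirical [simp]: "sets (empirical n y) = sets borel"
  using sets.sets_measure_of_eq[of borel] by (simp add: empirical_def)

lemma emeasure_empirical:
  assumes "A \<in> sets borel"
  shows "emeasure (empirical n y) A
    = ennreal (1 / real n) * (\<Sum>i = 1..n. emeasure (return borel (y i)) A)"
proof (rule emeasure_measure_of[OF empirical_def])
  let ?m = "\<lambda>A. ennreal (1 / real n) * (\<Sum>i = 1..n. emeasure (return borel (y i)) A)"
  show "countably_additive (sets (empirical n y)) ?m"
  proof (rule countably_additiveI)
    fix B :: "nat \<Rightarrow> 'a set"
    assume "range B \<subseteq> sets (empirical n y)" and d: "disjoint_family B"
    then have r: "range B \<subseteq> sets borel" by simp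
    have "(\<Sum>j. ?m (B j)) = ennreal (1 / real n) * (\<Sum>j. \<Sum>i = 1..n. emeasure (return borel (y i)) (B j))"
      by (simp add: ennreal_suminf_cmult)
    also have "\<dots> = ennreal (1 / real n) * (\<Sum>i = 1..n. \<Sum>j. emeasure (return borel (y i)) (B j))"
      by (simp only: suminf_sum[OF summableI])
    also have "\<dots> = ?m (\<Union> (range B))"
      using r d by (intro arg_cong2[where f="(*)"] sum.cong refl suminf_emeasure) auto
    finally show "(\<Sum>j. ?m (B j)) = ?m (\<Union> (range B))" .
  qed
qed (use assms in \<open>auto simp: positive_def\<close>)

lemma empirical_in_borel_probs:
  assumes "n \<ge> 1"
  shows "empirical n y \<in> borel_probs"
proof -
  have s: "space (empirical n y) = UNIV"
    using sets_eq_imp_space_eq[OF sets_empirical] by simp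
  have "emeasure (empirical n y) UNIV = ennreal (1 / real n) * of_nat n"
    by (subst emeasure_empirical) auto
  also have "\<dots> = 1"
    using assms by (simp add: ennreal_of_nat_eq_real_of_nat flip: ennreal_mult'')
  finally show ?thesis
    by (auto simp: space_prob_algebra s intro!: prob_spaceI)
qed

text \<open>Expectation of an extended-real random variable: integral of the positive part minus
  integral of the negative part (\<open>e2ennreal\<close> sends negative numbers to \<open>0\<close>). Meaningful if not
  both are infinite.\<close>

definition ereal_expectation :: "'b measure \<Rightarrow> ('b \<Rightarrow> ereal) \<Rightarrow> ereal" where
  "ereal_expectation M f =
     enn2ereal (\<integral>\<^sup>+ \<omega>. e2ennreal (f \<omega>) \<partial>M) - enn2ereal (\<integral>\<^sup>+ \<omega>. e2ennreal (- f \<omega>) \<partial>M)"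

text \<open>The sigma-algebra on the sample space generated by \<open>(X 1, \<dots>, X k)\<close>.\<close>

definition gen_sigma ::
    "'b measure \<Rightarrow> (nat \<Rightarrow> 'b \<Rightarrow> 'a::topological_space) \<Rightarrow> nat \<Rightarrow> 'b measure" where
  "gen_sigma M X k =
     vimage_algebra (space M) (\<lambda>\<omega>. \<lambda>i\<in>{1..k}. X i \<omega>) (Pi\<^sub>M {1..k} (\<lambda>_. borel))"

definition adapted_tuples ::
    "'b measure \<Rightarrow> (nat \<Rightarrow> 'b \<Rightarrow> 'a::topological_space) \<Rightarrow> nat \<Rightarrow> (nat \<Rightarrow> 'b \<Rightarrow> 'a) set" where
  "adapted_tuples M X n = (\<Pi>\<^sub>E k\<in>{1..n}. borel_measurable (gen_sigma M X k))"

end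

theory Submission
  imports Defs
begin

text \<open>
  Both suprema on the right run over the payoff \<open>F(\<pi>\<^sub>2) - \<integral> c d\<pi>\<close> of a coupling \<open>\<pi>\<close> with first marginal
  \<open>\<mu>\<close>, grouped or not grouped by the second marginal \<open>\<pi>\<^sub>2\<close>, so they agree (\<open>SUP_transport_cost\<close>).
  The limit is compared with the supremum of this payoff, called \<open>S\<close> below.

  Upper bound. For a fixed sample point the quantity inside the expectation is exactly the payoff of
  the empirical measure of the pairs \<open>(X\<^sub>i, Y\<^sub>i)\<close>. Its first marginal is the empirical measure of the
  \<open>X\<^sub>i\<close>, which with high probability is close to \<open>\<mu>\<close> and has little mass outside suitable compact sets,
  whatever the \<open>Y\<^sub>i\<close> are. So it is enough to know, deterministically, that a measure whose first
  marginal is close to \<open>\<mu>\<close> in this sense has payoff at most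
  \<open>S + \<epsilon>\<close> (\<open>payoff_upper_near_marginal\<close>). This is a compactness statement: for a sequence of
  counterexamples the costs are bounded, the compactness hypothesis on the sublevel sets of \<open>c\<close> then
  carries tightness over from the first marginals to the whole measures, and a limit point, which
  exists by Prokhorov's theorem, has first marginal \<open>\<mu>\<close> and payoff larger than \<open>S\<close> because \<open>F\<close> is
  continuous and \<open>\<integral> c\<close> is lower semicontinuous.

  Lower bound. Given a coupling \<open>\<pi>\<close> of finite cost, write \<open>\<pi>\<close> as the law of \<open>(x, \<phi>(x, u))\<close> with \<open>x\<close> of
  law \<open>\<mu>\<close> and \<open>u\<close> an independent uniform number (\<open>randomisation\<close>). With independent uniform \<open>u\<^sub>i\<close> the
  controls \<open>\<phi>(X\<^sub>i, u\<^sub>i)\<close> have the right expected cost, and by the law of large numbers their empirical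
  measure is close to \<open>\<pi>\<^sub>2\<close>. By Fubini's theorem some deterministic vector \<open>(u\<^sub>1, \<dots>, u\<^sub>n)\<close> does at least
  as well as the average, and for this vector \<open>\<phi>(X\<^sub>k, u\<^sub>k)\<close> is a function of \<open>X\<^sub>k\<close> alone.

  Two classical results are proved on the way, Prokhorov's theorem and the disintegration of a
  measure on a product, both by transport to the real line. A Borel map \<open>s\<close> codes points by elements
  of the Cantor set; it is discontinuous, but a point can be recovered from its code through a closed
  relation (\<open>borel_coding\<close>). Helly's selection theorem and conditional distribution functions on the
  real line then give the two results.
\<close>

section \<open>Coding points of a metric space by real numbers\<close>

text \<open>The ternary digits of a point of the Cantor set, halved, as continuous functions on the whole
  real line: the first one is \<open>cantor_digit\<close>, which interpolates linearly over the middle third, and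
  the next ones are read off after applying \<open>cantor_shift\<close>.\<close>

definition cantor_digit :: "real \<Rightarrow> real" where
  "cantor_digit x = max 0 (min 1 (3 * x - 1))"

definition cantor_shift :: "real \<Rightarrow> real" where
  "cantor_shift x = 3 * x - 2 * cantor_digit x"

definition cantor_code :: "(nat \<Rightarrow> bool) \<Rightarrow> real" where
  "cantor_code b = (\<Sum>j. 2 * of_bool (b j) / 3 ^ Suc j)"

lemma summable_cantor_code: "summable (\<lambda>j. 2 * of_bool (b j) / 3 ^ Suc j :: real)"
proof (rule summable_comparison_test)
  show "summable (\<lambda>j. 2 / 3 * (1 / 3) ^ j :: real)"
    by (intro summable_mult summable_geometric) simp
qed (auto intro!: exI[of _ 0] simp: power_divide field_simps)

lemma cantor_code_bounds: "cantor_code b \<in> {0..1}"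
proof -
  have g: "(\<lambda>j. 2 / 3 * (1 / 3) ^ j :: real) sums (2 / 3 * (1 / (1 - 1 / 3)))"
    by (intro sums_mult geometric_sums) simp
  have "cantor_code b \<le> (\<Sum>j. 2 / 3 * (1 / 3) ^ j)"
    unfolding cantor_code_def
    by (intro suminf_le summable_cantor_code sums_summable[OF g]) (auto simp: power_divide)
  also have "\<dots> = 1"
    using g by (simp add: sums_iff)
  finally show ?thesis
    using suminf_nonneg[OF summable_cantor_code[of b]] unfolding cantor_code_def by simp
qed

lemma cantor_code_rec: "cantor_code b = 2 / 3 * of_bool (b 0) + cantor_code (\<lambda>j. b (Suc j)) / 3"
proof -
  have "cantor_code b = 2 / 3 * of_bool (b 0) + (\<Sum>j. 2 * of_bool (b (Suc j)) / 3 ^ Suc (Suc j))"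
    unfolding cantor_code_def using suminf_split_head[OF summable_cantor_code[of b]] by simp
  also have "(\<Sum>j. 2 * of_bool (b (Suc j)) / 3 ^ Suc (Suc j)) = cantor_code (\<lambda>j. b (Suc j)) / 3"
    unfolding cantor_code_def using summable_cantor_code[of "\<lambda>j. b (Suc j)"]
    by (subst suminf_divide[symmetric]) (auto simp: field_simps)
  finally show ?thesis .
qed

lemma cantor_digit_code: "cantor_digit (cantor_code b) = of_bool (b 0)"
  using cantor_code_bounds[of "\<lambda>j. b (Suc j)"]
  by (auto simp: cantor_code_rec[of b] cantor_digit_def max_def min_def)

lemma cantor_shift_code: "cantor_shift (cantor_code b) = cantor_code (\<lambda>j. b (Suc j))"
  unfolding cantor_shift_def cantor_digit_code by (subst cantor_code_rec) simp

lemma nth_cantor_digit_code: "cantor_digit ((cantor_shift ^^ j) (cantor_code b)) = of_bool (b j)"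
proof -
  have "(cantor_shift ^^ j) (cantor_code b) = cantor_code (\<lambda>i. b (i + j))"
    by (induction j) (auto simp: cantor_shift_code)
  then show ?thesis by (simp add: cantor_digit_code)
qed

text \<open>Continuity on the whole line, not just on the Cantor set, makes the decoding relation below
  a closed subset of a product with \<open>\<real>\<close>.\<close>

lemma continuous_nth_cantor_digit:
  "continuous_on UNIV (\<lambda>x. cantor_digit ((cantor_shift ^^ j) x))"
proof -
  have d: "continuous_on UNIV cantor_digit"
    unfolding cantor_digit_def[abs_def] by (intro continuous_intros)
  then have s: "continuous_on UNIV cantor_shift"
    unfolding cantor_shift_def[abs_def] by (intro continuous_intros)
  have "continuous_on UNIV (cantor_shift ^^ j)"
  proof (induction j)
    case (Suc j)
    then show ?case
      using continuous_on_compose[OF Suc continuous_on_subset[OF s]] by (simp add: o_def)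
  qed (simp add: continuous_on_id)
  from continuous_on_compose[OF this continuous_on_subset[OF d]] show ?thesis
    by (simp add: o_def)
qed

text \<open>The pairs of disjoint basic open sets are countably many and separate points; their complements
  are pairs of closed sets that cover the space. A bit saying which of the two closed sets contains
  a point thus always exists, and the condition "bit \<open>1\<close> implies \<open>P\<close>, bit \<open>0\<close> implies \<open>Q\<close>" is closed,
  although the choice of the bit is only Borel.\<close>

lemma separating_closed_covers:
  obtains P Q :: "nat \<Rightarrow> 'a::{second_countable_topology, t2_space} set"
  where "\<And>j. closed (P j)" "\<And>j. closed (Q j)" "\<And>j. P j \<union> Q j = UNIV"
    "\<And>y z. y \<noteq> z \<Longrightarrow> \<exists>j. y \<notin> Q j \<and> z \<notin> P j"
proof -
  obtain B :: "nat \<Rightarrow> 'a set" where B: "topological_basis (range B)"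
  proof -
    obtain C :: "'a set set" where C: "countable C" "topological_basis C"
      using ex_countable_basis by auto
    have "C \<noteq> {}"
    proof
      assume "C = {}"
      with C(2) have "(UNIV :: 'a set) = {}"
        unfolding topological_basis_def by (metis Union_empty empty_subsetI open_UNIV subset_empty)
      then show False by simp
    qed
    with C show ?thesis
      by (intro that[of "from_nat_into C"]) (simp add: range_from_nat_into)
  qed
  have oB: "open (B i)" for i
    using topological_basis_open[OF B] by auto
  define G where "G j = (case prod_decode j of (a, b) \<Rightarrow> if B a \<inter> B b = {} then (B a, B b) else ({}, {}))" for j
  have oG: "open (fst (G j))" "open (snd (G j))" "fst (G j) \<inter> snd (G j) = {}" for j
    by (auto simp: G_def oB split: prod.splits)
  show ?thesis
  proof (rule that[of "\<lambda>j. - snd (G j)" "\<lambda>j. - fst (G j)"])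
    fix y z :: 'a assume "y \<noteq> z"
    then obtain U V where UV: "open U" "open V" "y \<in> U" "z \<in> V" "U \<inter> V = {}"
      using hausdorff by metis
    obtain B1 where B1: "B1 \<in> range B" "y \<in> B1" "B1 \<subseteq> U"
      by (rule topological_basisE[OF B UV(1,3)])
    obtain B2 where B2: "B2 \<in> range B" "z \<in> B2" "B2 \<subseteq> V"
      by (rule topological_basisE[OF B UV(2,4)])
    from B1 obtain a where a: "y \<in> B a" "B a \<subseteq> U" by (elim rangeE) simp
    from B2 obtain b where b: "z \<in> B b" "B b \<subseteq> V" by (elim rangeE) simp
    have "B a \<inter> B b = {}" using a b UV by auto
    then have "G (prod_encode (a, b)) = (B a, B b)" by (simp add: G_def)
    with a b show "\<exists>j. y \<notin> - fst (G j) \<and> z \<notin> - snd (G j)"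
      by (intro exI[of _ "prod_encode (a, b)"]) auto
  qed (use oG in \<open>auto simp: closed_Compl\<close>)
qed

lemma closed_projection_along_compact:
  fixes R :: "('a::metric_space \<times> 'b::metric_space) set"
  assumes "closed R" "compact A"
  shows "closed {x. \<exists>y\<in>A. (x, y) \<in> R}"
  unfolding closed_sequential_limits
proof safe
  fix x l assume x: "\<forall>n. x n \<in> {x. \<exists>y\<in>A. (x, y) \<in> R}" and l: "x \<longlonglongrightarrow> l"
  then have "\<forall>n. \<exists>y. y \<in> A \<and> (x n, y) \<in> R"
    by auto
  then obtain y where y: "\<And>n. y n \<in> A" "\<And>n. (x n, y n) \<in> R"
    unfolding choice_iff by auto
  obtain r z where r: "strict_mono r" "(y \<circ> r) \<longlonglongrightarrow> z" "z \<in> A"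
    using \<open>compact A\<close> y(1) unfolding compact_def by blast
  have "(\<lambda>n. ((x \<circ> r) n, (y \<circ> r) n)) \<longlonglongrightarrow> (l, z)"
    by (intro tendsto_Pair r LIMSEQ_subseq_LIMSEQ l)
  then have "(l, z) \<in> R"
    using \<open>closed R\<close> y(2) unfolding closed_sequential_limits by fastforce
  with r show "\<exists>y\<in>A. (l, y) \<in> R" by auto
qed

text \<open>The code of \<open>y\<close> has \<open>j\<close>-th digit \<open>1\<close> if and only if \<open>y \<in> P j\<close>. The relation \<open>R\<close> asks only that \<open>y\<close> lies
  in the closed set announced by each digit of \<open>x\<close>, which is closed in \<open>(x, y)\<close> and still determines \<open>y\<close>
  because the closed pairs separate points.\<close>

lemma closed_coding_relation:
  obtains s :: "'a::{second_countable_topology, t2_space} \<Rightarrow> real" and R :: "(real \<times> 'a) set"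
  where "s \<in> borel_measurable borel" "\<And>y. s y \<in> {0..1}" "closed R" "\<And>y. (s y, y) \<in> R"
    "\<And>x y z. (x, y) \<in> R \<Longrightarrow> (x, z) \<in> R \<Longrightarrow> y = z"
proof -
  obtain P Q :: "nat \<Rightarrow> 'a set"
    where PQ: "\<And>j. closed (P j)" "\<And>j. closed (Q j)" "\<And>j. P j \<union> Q j = UNIV"
      "\<And>y z. y \<noteq> z \<Longrightarrow> \<exists>j. y \<notin> Q j \<and> z \<notin> P j"
  proof (rule separating_closed_covers[where ?'a='a], goal_cases)
    case (1 P Q)
    show thesis by (rule that[of P Q]) (fact 1)+
  qed
  define D where "D j x = cantor_digit ((cantor_shift ^^ j) x)" for j x
  define s where "s y = cantor_code (\<lambda>j. y \<in> P j)" for y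
  have D_s: "D j (s y) = of_bool (y \<in> P j)" for j y
    unfolding D_def s_def by (rule nth_cantor_digit_code)
  have cD: "closed {x. D j x = a}" for j a
    unfolding D_def using continuous_closed_vimage[of "{a}"] continuous_nth_cantor_digit
    by (intro closed_Collect_eq continuous_on_const) auto
  define R where "R = (\<Inter>j. {x. D j x = 1} \<times> P j \<union> {x. D j x = 0} \<times> Q j)"
  show ?thesis
  proof
    show "s \<in> borel_measurable borel"
    proof -
      have "(\<lambda>y. \<Sum>j. 2 * indicator (P j) y / 3 ^ Suc j :: real) \<in> borel_measurable borel"
        by (intro borel_measurable_suminf borel_measurable_divide borel_measurable_times
            borel_measurable_const borel_measurable_indicator borel_closed PQ(1))
      then show ?thesis
        by (simp add: s_def[abs_def] cantor_code_def indicator_def of_bool_def)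
    qed
    show "s y \<in> {0..1}" for y
      unfolding s_def by (rule cantor_code_bounds)
    show "closed R"
      unfolding R_def by (intro closed_INT ballI closed_Un closed_Times cD PQ)
    show "(s y, y) \<in> R" for y
      using PQ(3) by (auto simp: R_def D_s)
    show "y = z" if y: "(x, y) \<in> R" and z: "(x, z) \<in> R" for x y z
    proof (rule ccontr)
      assume "y \<noteq> z"
      then obtain j where j: "y \<notin> Q j" "z \<notin> P j" using PQ(4) by blast
      have "D j x = 1" using y j by (auto simp: R_def)
      moreover have "D j x = 0" using z j by (auto simp: R_def)
      ultimately show False by simp
    qed
  qed
qed

text \<open>Over a sequence of compact sets the closed relation has a Borel inverse \<open>r\<close>. Applied to \<open>A = {y}\<close>
  the last clause says \<open>r (s y) = y\<close>. For general \<open>A\<close> it replaces the continuity that \<open>s\<close> lacks: compact sets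
  are enclosed in preimages of closed sets of codes that decode back into them, which is what the
  closed-set form of weak convergence needs.\<close>

lemma borel_coding:
  fixes K :: "nat \<Rightarrow> 'a::{second_countable_topology, metric_space} set"
  assumes K: "\<And>j. compact (K j)"
  obtains s :: "'a \<Rightarrow> real" and r :: "real \<Rightarrow> 'a"
  where "s \<in> borel_measurable borel" "\<And>y. s y \<in> {0..1}" "r \<in> borel_measurable borel"
    "\<And>j A. compact A \<Longrightarrow> A \<subseteq> K j \<Longrightarrow> \<exists>C. closed C \<and> s ` A \<subseteq> C \<and> r ` C \<subseteq> A"
proof -
  obtain s :: "'a \<Rightarrow> real" and R
    where s: "s \<in> borel_measurable borel" "\<And>y. s y \<in> {0..1}" and R: "closed R" "\<And>y. (s y, y) \<in> R"
      "\<And>x y z. (x, y) \<in> R \<Longrightarrow> (x, z) \<in> R \<Longrightarrow> y = z"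
    using closed_coding_relation by blast
  define C where "C A = {x. \<exists>y\<in>A. (x, y) \<in> R}" for A
  have C: "closed (C A)" if "compact A" for A
    unfolding C_def using R(1) that by (rule closed_projection_along_compact)
  define S where "S = (\<Union>j. K j)"
  define r where "r x = (if \<exists>y\<in>S. (x, y) \<in> R then SOME y. y \<in> S \<and> (x, y) \<in> R else undefined)" for x
  have r1: "r x = y" if "y \<in> S" "(x, y) \<in> R" for x y
  proof -
    have "\<exists>y\<in>S. (x, y) \<in> R" using that by auto
    then show ?thesis
      unfolding r_def using that R(3) by (metis (mono_tags, lifting) someI_ex)
  qed
  have r2: "r x = undefined" if "x \<notin> C S" for x
    using that by (auto simp: r_def C_def)
  have CS: "C S = (\<Union>j. C (K j))"
    by (auto simp: C_def S_def)
  have mCS: "C S \<in> sets borel"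
    unfolding CS by (intro sets.countable_UN) (auto intro!: borel_closed C K)
  show ?thesis
  proof
    show "r \<in> borel_measurable borel"
    proof (rule borel_measurableI)
      fix U :: "'a set" assume U: "open U"
      define A where "A = - U"
      have A: "closed A" using U by (simp add: A_def closed_def)
      have "r -` A \<inter> space borel = (\<Union>j. C (K j \<inter> A)) \<union> ((- C S) \<inter> (if undefined \<in> A then UNIV else {}))"
      proof (intro equalityI subsetI)
        fix x assume x: "x \<in> r -` A \<inter> space borel"
        show "x \<in> (\<Union>j. C (K j \<inter> A)) \<union> ((- C S) \<inter> (if undefined \<in> A then UNIV else {}))"
        proof (cases "x \<in> C S")
          case True
          then obtain y j where y: "(x, y) \<in> R" "y \<in> K j" by (auto simp: C_def S_def)
          then have "r x = y" by (intro r1) (auto simp: S_def)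
          with x y show ?thesis by (auto simp: C_def)
        qed (use x r2 in auto)
      next
        fix x assume "x \<in> (\<Union>j. C (K j \<inter> A)) \<union> ((- C S) \<inter> (if undefined \<in> A then UNIV else {}))"
        then show "x \<in> r -` A \<inter> space borel"
        proof
          assume "x \<in> (\<Union>j. C (K j \<inter> A))"
          then obtain y j where y: "(x, y) \<in> R" "y \<in> K j" "y \<in> A" by (auto simp: C_def)
          then have "r x = y" by (intro r1) (auto simp: S_def)
          with y show ?thesis by simp
        qed (use r2 in \<open>auto split: if_splits\<close>)
      qed
      also have "\<dots> \<in> sets borel"
        using mCS by (intro sets.Un sets.Int sets.countable_UN) (auto intro!: borel_closed C compact_Int_closed K A)
      finally have "space borel - (r -` A \<inter> space borel) \<in> sets borel" by (rule sets.compl_sets)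
      also have "space borel - (r -` A \<inter> space borel) = r -` U \<inter> space borel"
        by (auto simp: A_def)
      finally show "r -` U \<inter> space borel \<in> sets borel" .
    qed
    fix j A assume A: "compact A" "A \<subseteq> K j"
    show "\<exists>C. closed C \<and> s ` A \<subseteq> C \<and> r ` C \<subseteq> A"
    proof (intro exI[of _ "C A"] conjI)
      show "closed (C A)" using A by (intro C)
      show "s ` A \<subseteq> C A" using R(2) by (auto simp: C_def)
      have "r x = y" if "(x, y) \<in> R" "y \<in> A" for x y
        using that A(2) by (intro r1) (auto simp: S_def)
      then show "r ` C A \<subseteq> A" by (auto simp: C_def)
    qed
  qed (use s in auto)
qed

section \<open>Prokhorov's theorem\<close>

lemma borel_probsD:
  assumes "p \<in> borel_probs"
  shows "prob_space p" "sets p = sets borel" "space p = UNIV"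
  using assms sets_eq_imp_space_eq[of p borel] by (auto simp: space_prob_algebra)

lemma distr_borel_probs:
  assumes "p \<in> borel_probs" "f \<in> borel_measurable borel"
  shows "distr p borel f \<in> borel_probs"
proof -
  interpret prob_space p using assms by (simp add: borel_probsD)
  have "f \<in> measurable p borel"
    using assms measurable_cong_sets[OF borel_probsD(2)[OF assms(1)] refl] by auto
  then show ?thesis
    by (auto simp: space_prob_algebra intro: prob_space_distr)
qed

text \<open>The portmanteau form of weak convergence of probability measures. Codes of points control
  exactly the masses of closed sets, and by the layer cake formula bounds on open sets integrate to bounds
  for lower semicontinuous functions.\<close>

definition portmanteau_conv :: "(nat \<Rightarrow> 'a::topological_space measure) \<Rightarrow> 'a measure \<Rightarrow> bool" where
  "portmanteau_conv p q \<longleftrightarrow> (\<forall>U. open U \<longrightarrow> emeasure q U \<le> liminf (\<lambda>n. emeasure (p n) U))"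

text \<open>The indicator of a closed set is the decreasing limit of the continuous functions
  \<open>max 0 (1 - N d(x, C))\<close>.\<close>

lemma weak_conv_closed_upper:
  fixes q :: "nat \<Rightarrow> real measure"
  assumes q: "\<And>n. real_distribution (q n)" and m: "real_distribution m" and "weak_conv_m q m"
    and C: "closed C" and "0 < e"
  shows "eventually (\<lambda>n. measure (q n) C \<le> measure m C + e) sequentially"
proof (cases "C = {}")
  case False
  interpret m: real_distribution m by fact
  interpret q: real_distribution "q n" for n by (rule q)
  define f where "f N x = max 0 (1 - real N * infdist x C)" for N x
  have f_cont: "continuous_on UNIV (f N)" for N
    unfolding f_def[abs_def] by (intro continuous_intros)
  have f_bd: "0 \<le> f N x" "f N x \<le> 1" for N x
    by (auto simp: f_def infdist_nonneg)
  have mf: "f N \<in> borel_measurable borel" for N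
    by (intro borel_measurable_continuous_onI f_cont)
  have f_lim: "(\<lambda>N. f N x) \<longlonglongrightarrow> indicator C x" for x
  proof (cases "x \<in> C")
    case True
    then show ?thesis by (simp add: f_def)
  next
    case nx: False
    then have pos: "infdist x C > 0"
      using C False by (metis in_closed_iff_infdist_zero infdist_nonneg less_eq_real_def)
    obtain N0 :: nat where N0: "1 / infdist x C < N0" using reals_Archimedean2 by blast
    have "f N x = 0" if "N \<ge> N0" for N
    proof -
      have "1 < real N0 * infdist x C" using N0 pos by (simp add: field_simps)
      also have "\<dots> \<le> real N * infdist x C" using that pos by simp
      finally show ?thesis by (simp add: f_def)
    qed
    then have "eventually (\<lambda>N. f N x = 0) sequentially"
      by (auto simp: eventually_sequentially)
    with nx show ?thesis by (simp add: tendsto_eventually)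
  qed
  have "(\<lambda>N. LINT x|m. f N x) \<longlonglongrightarrow> (LINT x|m. indicator C x)"
    by (rule integral_dominated_convergence[where w="\<lambda>_. 1"])
      (use mf f_bd f_lim C in \<open>auto\<close>)
  then have "(\<lambda>N. LINT x|m. f N x) \<longlonglongrightarrow> measure m C" using C by simp
  from order_tendstoD(2)[OF this, of "measure m C + e"] \<open>0 < e\<close>
  obtain N where N: "(LINT x|m. f N x) < measure m C + e"
    by (auto simp: eventually_sequentially)
  have "(\<lambda>n. LINT x|q n. f N x) \<longlonglongrightarrow> (LINT x|m. f N x)"
    by (rule weak_conv_imp_integral_bdd_continuous_conv[OF q m \<open>weak_conv_m q m\<close>, of _ 1])
      (use f_bd f_cont in \<open>auto simp: continuous_on_eq_continuous_at\<close>)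
  from order_tendstoD(2)[OF this N] show ?thesis
  proof eventually_elim
    case (elim n)
    have "measure (q n) C = (LINT x|q n. indicator C x)" using C by simp
    also have "\<dots> \<le> (LINT x|q n. f N x)"
    proof (rule integral_mono)
      show "integrable (q n) (indicator C :: real \<Rightarrow> real)"
        using C by (intro q.integrable_const_bound[where B=1]) auto
      show "integrable (q n) (f N)"
        using f_bd mf by (intro q.integrable_const_bound[where B=1]) auto
      show "indicator C x \<le> f N x" for x
        using f_bd[of N x] by (auto simp: f_def indicator_def)
    qed
    finally show ?case using elim by simp
  qed
qed (use \<open>0 < e\<close> in simp)

lemma portmanteau_convI:
  assumes p: "\<And>n. p n \<in> borel_probs" and q: "q \<in> borel_probs"
    and ev: "\<And>A e. closed A \<Longrightarrow> 0 < e \<Longrightarrow> eventually (\<lambda>n. measure (p n) A \<le> measure q A + e) sequentially"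
  shows "portmanteau_conv p q"
  unfolding portmanteau_conv_def
proof (intro allI impI)
  fix U :: "'a set" assume U: "open U"
  interpret p: prob_space "p n" for n using p by (rule borel_probsD)
  interpret q: prob_space q using q by (rule borel_probsD)
  have compl: "measure (p n) (- U) = 1 - measure (p n) U" "measure q (- U) = 1 - measure q U" for n
    using p.prob_compl[of U n] q.prob_compl[of U] U borel_probsD[OF p[of n]] borel_probsD[OF q]
    by (auto simp: Compl_eq_Diff_UNIV)
  show "emeasure q U \<le> liminf (\<lambda>n. emeasure (p n) U)"
    unfolding le_Liminf_iff
  proof (intro allI impI)
    fix y assume y: "y < emeasure q U"
    then obtain b where b: "y = ennreal b" "0 \<le> b" by (cases y) auto
    then have lt: "b < measure q U" using y by (simp add: q.emeasure_eq_measure ennreal_less_iff)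
    then have "eventually (\<lambda>n. measure (p n) (-U) \<le> measure q (-U) + (measure q U - b) / 2) sequentially"
      using U by (intro ev) auto
    then show "eventually (\<lambda>n. y < emeasure (p n) U) sequentially"
    proof eventually_elim
      case (elim n)
      then have "b < measure (p n) U" using lt unfolding compl by argo
      then show ?case using b by (simp add: p.emeasure_eq_measure ennreal_less_iff)
    qed
  qed
qed

text \<open>The codes of the measures live on \<open>[0, 1]\<close>, so Helly's theorem gives a limit law of codes, and its image
  under the decoding map \<open>r\<close> is the limit measure. Closed sets pass to the limit after intersecting them
  with a compact set that carries almost all of the mass, since compact sets are enclosed in closed sets
  of codes.\<close>

lemma prokhorov:
  fixes p :: "nat \<Rightarrow> 'a::{second_countable_topology, metric_space} measure"
  assumes p: "\<And>n. p n \<in> borel_probs" and K: "\<And>j. compact (K j)"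
    and bd: "\<And>n j. measure (p n) (- K j) \<le> e j" and e: "e \<longlonglongrightarrow> 0"
  obtains \<phi> q where "strict_mono \<phi>" "q \<in> borel_probs" "portmanteau_conv (p \<circ> \<phi>) q"
proof -
  obtain s :: "'a \<Rightarrow> real" and r where s: "s \<in> borel_measurable borel" "\<And>y. s y \<in> {0..1}"
    and r: "r \<in> borel_measurable borel"
    and code: "\<And>j A. compact A \<Longrightarrow> A \<subseteq> K j \<Longrightarrow> \<exists>C. closed C \<and> s ` A \<subseteq> C \<and> r ` C \<subseteq> A"
    using borel_coding[of K, OF K] by metis
  interpret p: prob_space "p n" for n using p by (rule borel_probsD)
  have sp[simp]: "sets (p n) = sets borel" "space (p n) = UNIV" for n
    using borel_probsD[OF p] by auto
  have s_meas: "s \<in> borel_measurable (p n)" for n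
    using s(1) by (simp cong: measurable_cong_sets)
  define Q where "Q n = distr (p n) borel s" for n
  have Q: "real_distribution (Q n)" for n
    unfolding Q_def by (intro p.real_distribution_distr s_meas)
  have Q_eq: "measure (Q n) A = measure (p n) (s -` A)" if "A \<in> sets borel" for n A
    unfolding Q_def using that s_meas by (subst measure_distr) auto
  have "tight Q"
    unfolding tight_def
  proof (intro conjI allI impI Q)
    fix \<epsilon> :: real assume "0 < \<epsilon>"
    have "measure (Q n) {- 1<..1} = 1" for n
    proof -
      have "s -` {- 1<..1} = UNIV"
      proof (intro equalityI subsetI)
        fix y :: 'a
        have "- 1 < s y" "s y \<le> 1" using s(2)[of y] by auto
        then show "y \<in> s -` {- 1<..1}" by simp
      qed simp
      then show ?thesis
        using p.prob_space[of n] by (simp add: Q_eq)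
    qed
    with \<open>0 < \<epsilon>\<close> show "\<exists>a b. a < b \<and> (\<forall>n. 1 - \<epsilon> < measure (Q n) {a<..b})"
      by (intro exI[of _ "-1"] exI[of _ 1]) simp
  qed
  from tight_imp_convergent_subsubsequence[OF this strict_mono_id]
  obtain \<phi> m where \<phi>: "strict_mono \<phi>" and m: "real_distribution m" and conv: "weak_conv_m (Q \<circ> \<phi>) m"
    by auto
  interpret m: real_distribution m by fact
  define q where "q = distr m borel r"
  have q_eq: "measure q A = measure m (r -` A)" if "A \<in> sets borel" for A
    unfolding q_def using that r by (subst measure_distr) auto
  have q: "q \<in> borel_probs"
    unfolding q_def using r by (auto simp: space_prob_algebra intro!: m.prob_space_distr)
  have "portmanteau_conv (p \<circ> \<phi>) q"
  proof (rule portmanteau_convI)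
    fix A :: "'a set" and d :: real assume A: "closed A" and "0 < d"
    obtain j where j: "e j < d / 2"
      using order_tendstoD(2)[OF e, of "d/2"] \<open>0 < d\<close> by (auto simp: eventually_sequentially)
    obtain C where C: "closed C" "s ` (A \<inter> K j) \<subseteq> C" "r ` C \<subseteq> A \<inter> K j"
      using code[of "A \<inter> K j" j] A K by (metis closed_Int_compact inf_le2)
    have "measure m C \<le> measure m (r -` A)"
      using C r A measurable_sets[OF r, of A] by (intro m.finite_measure_mono) auto
    then have mC: "measure m C \<le> measure q A" using A by (simp add: q_eq)
    have pQ: "measure (p n) A \<le> measure (Q n) C + d / 2" for n
    proof -
      have "measure (p n) A \<le> measure (p n) (s -` C \<union> - K j)"
        using C s_meas[of n] K[of j] A measurable_sets[OF s_meas, of C n]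
        by (intro p.finite_measure_mono) (auto simp: compact_imp_closed)
      also have "\<dots> \<le> measure (p n) (s -` C) + measure (p n) (- K j)"
        using C K[of j] measurable_sets[OF s_meas, of C n]
        by (intro measure_Un_le) (auto simp: compact_imp_closed)
      finally show ?thesis using bd[of n j] j C by (simp add: Q_eq)
    qed
    have "eventually (\<lambda>n. measure ((Q \<circ> \<phi>) n) C \<le> measure m C + d / 2) sequentially"
      using Q m conv C \<open>0 < d\<close> by (intro weak_conv_closed_upper) (auto simp: o_def)
    then show "eventually (\<lambda>n. measure ((p \<circ> \<phi>) n) A \<le> measure q A + d) sequentially"
    proof eventually_elim
      case (elim n)
      then have "measure (Q (\<phi> n)) C \<le> measure m C + d / 2" by (simp only: comp_apply)
      then have "measure (p (\<phi> n)) A \<le> measure q A + d" using pQ[of "\<phi> n"] mC by argo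
      then show ?case by (simp only: comp_apply)
    qed
  qed (use p q in auto)
  with \<phi> q show ?thesis by (rule that)
qed

section \<open>Lower semicontinuous costs and continuous functionals under weak convergence\<close>

lemma lower_semicontinuous_measurable:
  assumes "lower_semicontinuous f"
  shows "f \<in> borel_measurable borel"
  using assms by (intro borel_measurableI_greater) (auto simp: lower_semicontinuous_def)

lemma ennreal_eq_length_below:
  "(y :: ennreal) = (\<integral>\<^sup>+ t. indicator {0..} t * indicator {t. ennreal t < y} t \<partial>lborel)"
proof -
  have eq: "(\<integral>\<^sup>+ t. indicator {0..} t * indicator {t. ennreal t < y} t \<partial>lborel)
      = emeasure lborel {t. 0 \<le> t \<and> ennreal t < y}"
  proof -
    have "(\<integral>\<^sup>+ t. indicator {0..} t * indicator {t. ennreal t < y} t \<partial>lborel)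
      = (\<integral>\<^sup>+ t. indicator {t. 0 \<le> t \<and> ennreal t < y} t \<partial>lborel)"
      by (intro nn_integral_cong) (simp add: indicator_def)
    also have "\<dots> = emeasure lborel {t. 0 \<le> t \<and> ennreal t < y}"
      by (rule nn_integral_indicator) measurable
    finally show ?thesis .
  qed
  show ?thesis
  proof (cases y)
    case (real a)
    then have "{t. 0 \<le> t \<and> ennreal t < y} = {0..<a}"
      by (auto simp: ennreal_less_iff)
    then show ?thesis using real eq by simp
  next
    case top
    then have half_line: "{t. 0 \<le> t \<and> ennreal t < y} = {0::real..}" by auto
    have "emeasure lborel {0::real..} = top"
    proof (rule ccontr)
      assume "emeasure lborel {0::real..} \<noteq> top"
      then obtain a where a: "emeasure lborel {0::real..} = ennreal a" "0 \<le> a"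
        by (cases "emeasure lborel {0::real..}") auto
      have "emeasure lborel {0..a + 1} \<le> emeasure lborel {0::real..}"
        by (intro emeasure_mono) auto
      with a show False by simp
    qed
    then show ?thesis using top eq half_line by simp
  qed
qed

text \<open>Reduces integrals of lower semicontinuous functions to measures of open sets.\<close>

lemma nn_integral_layer_cake:
  fixes f :: "'a \<Rightarrow> ennreal"
  assumes "sigma_finite_measure M" and f[measurable]: "f \<in> borel_measurable M"
  shows "(\<integral>\<^sup>+ x. f x \<partial>M) = (\<integral>\<^sup>+ t. indicator {0..} t * emeasure M {x \<in> space M. ennreal t < f x} \<partial>lborel)"
proof -
  interpret M: sigma_finite_measure M by fact
  interpret pair_sigma_finite M lborel ..
  have "(\<integral>\<^sup>+ x. f x \<partial>M) = (\<integral>\<^sup>+ x. (\<integral>\<^sup>+ t. indicator {0..} t * indicator {t. ennreal t < f x} t \<partial>lborel) \<partial>M)"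
    by (subst ennreal_eq_length_below) simp
  also have "\<dots> = (\<integral>\<^sup>+ t. (\<integral>\<^sup>+ x. indicator {0..} t * indicator {t. ennreal t < f x} t \<partial>M) \<partial>lborel)"
    by (rule Fubini'[symmetric]) measurable
  also have "\<dots> = (\<integral>\<^sup>+ t. indicator {0..} t * emeasure M {x \<in> space M. ennreal t < f x} \<partial>lborel)"
  proof (intro nn_integral_cong)
    fix t
    have "(\<integral>\<^sup>+ x. indicator {0..} t * indicator {t. ennreal t < f x} t \<partial>M)
      = (\<integral>\<^sup>+ x. indicator {0..} t * indicator {x \<in> space M. ennreal t < f x} x \<partial>M)"
      by (intro nn_integral_cong) (simp add: indicator_def)
    also have "\<dots> = indicator {0..} t * emeasure M {x \<in> space M. ennreal t < f x}"
      by (subst nn_integral_cmult) (auto simp del: nn_integral_indicator simp: nn_integral_indicator)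
    finally show "(\<integral>\<^sup>+ x. indicator {0..} t * indicator {t. ennreal t < f x} t \<partial>M)
      = indicator {0..} t * emeasure M {x \<in> space M. ennreal t < f x}" .
  qed
  finally show ?thesis .
qed

text \<open>By the layer cake formula and Fatou's lemma for the variable \<open>t\<close>, as every superlevel set is open.\<close>

lemma portmanteau_conv_nn_integral:
  assumes conv: "portmanteau_conv p q" and p: "\<And>n. p n \<in> borel_probs" and q: "q \<in> borel_probs"
    and f: "lower_semicontinuous f"
  shows "(\<integral>\<^sup>+ x. f x \<partial>q) \<le> liminf (\<lambda>n. \<integral>\<^sup>+ x. f x \<partial>p n)"
proof -
  have lc: "(\<integral>\<^sup>+ x. f x \<partial>r) = (\<integral>\<^sup>+ t. indicator {0..} t * emeasure r {x. ennreal t < f x} \<partial>lborel)"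
    and meas: "(\<lambda>t. indicator {0..} t * emeasure r {x. ennreal t < f x}) \<in> borel_measurable lborel"
    if "r \<in> borel_probs" for r
  proof -
    interpret prob_space r using that by (rule borel_probsD)
    have [measurable]: "f \<in> borel_measurable r"
      using lower_semicontinuous_measurable[OF f] borel_probsD(2)[OF that]
      by (simp cong: measurable_cong_sets)
    show "(\<integral>\<^sup>+ x. f x \<partial>r) = (\<integral>\<^sup>+ t. indicator {0..} t * emeasure r {x. ennreal t < f x} \<partial>lborel)"
      using nn_integral_layer_cake[OF sigma_finite_measure_axioms, of f] borel_probsD(3)[OF that] by simp
    have "(\<lambda>t. emeasure r {x \<in> space r. ennreal t < f x}) \<in> borel_measurable lborel"
      by measurable
    then show "(\<lambda>t. indicator {0..} t * emeasure r {x. ennreal t < f x}) \<in> borel_measurable lborel"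
      using borel_probsD(3)[OF that] by simp
  qed
  have "(\<integral>\<^sup>+ x. f x \<partial>q) \<le> (\<integral>\<^sup>+ t. liminf (\<lambda>n. indicator {0..} t * emeasure (p n) {x. ennreal t < f x}) \<partial>lborel)"
    unfolding lc[OF q]
  proof (intro nn_integral_mono)
    fix t :: real
    have "emeasure q {x. ennreal t < f x} \<le> liminf (\<lambda>n. emeasure (p n) {x. ennreal t < f x})"
      using conv f by (auto simp: portmanteau_conv_def lower_semicontinuous_def)
    then show "indicator {0..} t * emeasure q {x. ennreal t < f x}
        \<le> liminf (\<lambda>n. indicator {0..} t * emeasure (p n) {x. ennreal t < f x})"
      by (cases "t \<in> {0..}") auto
  qed
  also have "\<dots> \<le> liminf (\<lambda>n. \<integral>\<^sup>+ t. indicator {0..} t * emeasure (p n) {x. ennreal t < f x} \<partial>lborel)"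
    by (intro nn_integral_liminf meas p)
  also have "\<dots> = liminf (\<lambda>n. \<integral>\<^sup>+ x. f x \<partial>p n)"
    by (simp add: lc[OF p])
  finally show ?thesis .
qed

text \<open>\<open>f + B\<close> is nonnegative and continuous, hence covered by the lower semicontinuous case.\<close>

lemma portmanteau_conv_integral_lower:
  fixes f :: "'a::topological_space \<Rightarrow> real"
  assumes conv: "portmanteau_conv p q" and p: "\<And>n. p n \<in> borel_probs" and q: "q \<in> borel_probs"
    and f: "continuous_on UNIV f" and B: "\<And>x. \<bar>f x\<bar> \<le> B" and a: "a < (LINT x|q. f x)"
  shows "eventually (\<lambda>n. a < (LINT x|p n. f x)) sequentially"
proof -
  have eq: "(\<integral>\<^sup>+ x. ennreal (f x + B) \<partial>r) = ennreal ((LINT x|r. f x) + B)"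
    and ge: "- B \<le> (LINT x|r. f x)" if "r \<in> borel_probs" for r
  proof -
    interpret prob_space r using that by (rule borel_probsD)
    have "f \<in> borel_measurable r"
      using borel_measurable_continuous_onI[OF f] borel_probsD(2)[OF that]
      by (simp cong: measurable_cong_sets)
    then have int: "integrable r f"
      using B by (intro integrable_const_bound[where B=B]) auto
    have nn: "0 \<le> f x + B" for x using B[of x] by linarith
    have "(\<integral>\<^sup>+ x. ennreal (f x + B) \<partial>r) = ennreal (LINT x|r. f x + B)"
      using int nn by (intro nn_integral_eq_integral) auto
    then show "(\<integral>\<^sup>+ x. ennreal (f x + B) \<partial>r) = ennreal ((LINT x|r. f x) + B)"
      using int prob_space by simp
    have "0 \<le> (LINT x|r. f x + B)" using nn by (intro integral_nonneg_AE) auto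
    then show "- B \<le> (LINT x|r. f x)" using int prob_space by simp
  qed
  have "lower_semicontinuous (\<lambda>x. ennreal (f x + B))"
    unfolding lower_semicontinuous_def
    by (intro allI open_Collect_less continuous_on_const continuous_on_ennreal
        continuous_on_add f)
  from portmanteau_conv_nn_integral[OF conv p q this]
  have "ennreal ((LINT x|q. f x) + B) \<le> liminf (\<lambda>n. ennreal ((LINT x|p n. f x) + B))"
    by (simp add: eq p q)
  moreover have "ennreal (max (- B) a + B) < ennreal ((LINT x|q. f x) + B) \<or> a < - B"
    using a ge[OF q] by (auto simp: ennreal_less_iff max_def)
  ultimately consider "eventually (\<lambda>n. ennreal (max (- B) a + B) < ennreal ((LINT x|p n. f x) + B)) sequentially"
    | "a < - B"
    unfolding le_Liminf_iff by blast
  then show ?thesis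
  proof cases
    case 1
    then show ?thesis
      by eventually_elim (auto simp: ennreal_less_iff)
  next
    case 2
    then have "a < (LINT x|p n. f x)" for n using ge[OF p[of n]] by linarith
    then show ?thesis by simp
  qed
qed

lemma portmanteau_conv_integral:
  fixes f :: "'a::topological_space \<Rightarrow> real"
  assumes conv: "portmanteau_conv p q" and p: "\<And>n. p n \<in> borel_probs" and q: "q \<in> borel_probs"
    and f: "continuous_on UNIV f" and bd: "bounded (range f)"
  shows "(\<lambda>n. LINT x|p n. f x) \<longlonglongrightarrow> (LINT x|q. f x)"
proof -
  obtain B where B: "\<And>x. \<bar>f x\<bar> \<le> B" using bd by (auto simp: bounded_iff)
  show ?thesis
  proof (rule order_tendstoI)
    fix a assume "a < (LINT x|q. f x)"
    then show "eventually (\<lambda>n. a < (LINT x|p n. f x)) sequentially"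
      by (rule portmanteau_conv_integral_lower[OF conv p q f B])
  next
    fix a assume "(LINT x|q. f x) < a"
    then have "- a < (LINT x|q. - f x)" by simp
    then have "eventually (\<lambda>n. - a < (LINT x|p n. - f x)) sequentially"
      using B by (intro portmanteau_conv_integral_lower[OF conv p q, where B=B] continuous_on_minus f) auto
    then show "eventually (\<lambda>n. (LINT x|p n. f x) < a) sequentially" by simp
  qed
qed

lemma portmanteau_conv_limitin:
  assumes conv: "portmanteau_conv p q" and p: "\<And>n. p n \<in> borel_probs" and q: "q \<in> borel_probs"
  shows "limitin weak_topology p q sequentially"
  unfolding limitin_def
proof (intro conjI allI impI)
  show "q \<in> topspace weak_topology" using q by (simp add: topspace_weak_topology)
  fix W assume "openin weak_topology W \<and> q \<in> W"
  then have "generate_topology_on {{\<nu> \<in> borel_probs. (LINT x|\<nu>. f x) \<in> U} | f U.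
        continuous_on UNIV f \<and> bounded (range f) \<and> open (U :: real set)} W" "q \<in> W"
    unfolding weak_topology_def openin_topology_generated_by_iff by auto
  then show "eventually (\<lambda>n. p n \<in> W) sequentially"
  proof (induction rule: generate_topology_on.induct)
    case (Int a b)
    then show ?case by (auto intro: eventually_conj)
  next
    case (UN K)
    then obtain k where "k \<in> K" "q \<in> k" by auto
    with UN.IH[of k] show ?case by (auto elim!: eventually_mono)
  next
    case (Basis s)
    then obtain f U where s: "s = {\<nu> \<in> borel_probs. (LINT x|\<nu>. f x) \<in> U}"
      and f: "continuous_on UNIV f" "bounded (range f)" and U: "open (U :: real set)"
      by auto
    have "eventually (\<lambda>n. (LINT x|p n. f x) \<in> U) sequentially"
      using topological_tendstoD[OF portmanteau_conv_integral[OF conv p q f] U] Basis s by auto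
    then show ?case using p by (auto simp: s)
  qed simp
qed

lemma portmanteau_conv_continuous_functional:
  assumes conv: "portmanteau_conv p q" and p: "\<And>n. p n \<in> borel_probs" and q: "q \<in> borel_probs"
    and F: "continuous_map weak_topology euclideanreal F"
  shows "(\<lambda>n. F (p n)) \<longlonglongrightarrow> F q"
  using continuous_map_limit[OF F portmanteau_conv_limitin[OF conv p q]] by (simp add: o_def)

lemma portmanteau_conv_distr:
  assumes conv: "portmanteau_conv p q" and p: "\<And>n. p n \<in> borel_probs" and q: "q \<in> borel_probs"
    and f: "continuous_on UNIV f"
  shows "portmanteau_conv (\<lambda>n. distr (p n) borel f) (distr q borel f)"
  unfolding portmanteau_conv_def
proof (intro allI impI)
  fix U :: "'b set" assume U: "open U"
  have eq: "emeasure (distr r borel f) U = emeasure r (f -` U)" if "r \<in> borel_probs" for r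
  proof -
    have "f \<in> borel_measurable r"
      using borel_measurable_continuous_onI[OF f] borel_probsD(2)[OF that]
      by (simp cong: measurable_cong_sets)
    then show ?thesis using U borel_probsD(3)[OF that] by (subst emeasure_distr) auto
  qed
  have "open (f -` U)" using f U by (simp add: open_vimage)
  then show "emeasure (distr q borel f) U \<le> liminf (\<lambda>n. emeasure (distr (p n) borel f) U)"
    using conv by (simp add: eq p q portmanteau_conv_def)
qed

text \<open>Finite unions of basic open sets. Closeness of two laws needs to be tested only on finitely many of
  these sets, which is why the law of large numbers is needed for finitely many events only.\<close>

lemma countable_open_approximation:
  obtains U :: "nat \<Rightarrow> 'a::second_countable_topology set"
  where "\<And>i. open (U i)"
    "\<And>G. open G \<Longrightarrow> \<exists>k. incseq (\<lambda>j. U (k j)) \<and> (\<Union>j. U (k j)) = G"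
proof -
  obtain C :: "'a set set" where C: "countable C" "topological_basis C"
    using ex_countable_basis by auto
  define D where "D = {\<Union>\<F> | \<F>. finite \<F> \<and> \<F> \<subseteq> C}"
  have "D = \<Union> ` {\<F>. finite \<F> \<and> \<F> \<subseteq> C}" by (auto simp: D_def)
  then have cD: "countable D"
    using countable_Collect_finite_subset[OF C(1)] by simp
  have "\<Union>{} \<in> D" unfolding D_def by blast
  then have neD: "D \<noteq> {}" by blast
  have rD: "range (from_nat_into D) = D" using neD cD by (rule range_from_nat_into)
  have oD: "open d" if "d \<in> D" for d
    using that topological_basis_open[OF C(2)] by (auto simp: D_def intro!: open_Union)
  show ?thesis
  proof
    show "open (from_nat_into D i)" for i
      by (intro oD from_nat_into neD)
    fix G :: "'a set" assume G: "open G"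
    then obtain C' where C': "C' \<subseteq> C" "\<Union>C' = G"
      using C(2) unfolding topological_basis_def by auto
    have cC': "countable C'" using C'(1) C(1) by (rule countable_subset)
    define V where "V j = \<Union>{c \<in> C'. to_nat_on C' c < j}" for j
    have fin: "finite {c \<in> C'. to_nat_on C' c < j}" for j
    proof (rule finite_imageD)
      show "finite (to_nat_on C' ` {c \<in> C'. to_nat_on C' c < j})"
        by (rule finite_subset[of _ "{..<j}"]) auto
      show "inj_on (to_nat_on C') {c \<in> C'. to_nat_on C' c < j}"
        using inj_on_to_nat_on[OF cC'] by (rule inj_on_subset) auto
    qed
    have "V j \<in> D" for j
      unfolding D_def V_def using fin[of j] C'(1) by blast
    then have "\<exists>k. from_nat_into D k = V j" for j using rD by (metis imageE)
    then obtain k where k: "\<And>j. from_nat_into D (k j) = V j" by metis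
    have "incseq V" by (fastforce simp: incseq_def V_def)
    moreover have "(\<Union>j. V j) = G"
      unfolding V_def C'(2)[symmetric] by (auto intro: lessI)
    ultimately show "\<exists>k. incseq (\<lambda>j. from_nat_into D (k j)) \<and> (\<Union>j. from_nat_into D (k j)) = G"
      using k by (intro exI[of _ k]) simp
  qed
qed

text \<open>Passes an inequality from the countable family to all open sets. The right side \<open>g\<close> is a set function
  rather than a measure so that it can be a \<open>liminf\<close> of measures.\<close>

lemma emeasure_open_le_if_approximation:
  fixes U :: "nat \<Rightarrow> 'a::topological_space set"
  assumes U: "\<And>i. open (U i)" "\<And>G. open G \<Longrightarrow> \<exists>k. incseq (\<lambda>j. U (k j)) \<and> (\<Union>j. U (k j)) = G"
    and q: "sets q = sets borel" and g: "\<And>A B. A \<subseteq> B \<Longrightarrow> open A \<Longrightarrow> open B \<Longrightarrow> g A \<le> (g B :: ennreal)"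
    and le: "\<And>i. emeasure q (U i) \<le> g (U i)" and G: "open G"
  shows "emeasure q G \<le> g G"
proof -
  obtain k where k: "incseq (\<lambda>j. U (k j))" "(\<Union>j. U (k j)) = G" using U(2)[OF G] by auto
  have "emeasure q G = (SUP j. emeasure q (U (k j)))"
    unfolding k(2)[symmetric] by (rule SUP_emeasure_incseq[symmetric]) (use U q k in auto)
  also have "\<dots> \<le> g G"
  proof (intro SUP_least)
    fix j
    have "emeasure q (U (k j)) \<le> g (U (k j))" by (rule le)
    also have "\<dots> \<le> g G" using k U G by (intro g) auto
    finally show "emeasure q (U (k j)) \<le> g G" .
  qed
  finally show ?thesis .
qed

text \<open>Outer regularity extends the inequality to all Borel sets, and passing to complements reverses it.\<close>

lemma borel_probs_eqI_open:
  fixes p q :: "'a::polish_space measure"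
  assumes p: "p \<in> borel_probs" and q: "q \<in> borel_probs"
    and le: "\<And>U. open U \<Longrightarrow> emeasure p U \<le> emeasure q U"
  shows "p = q"
proof (rule measure_eqI)
  interpret p: prob_space p using p by (rule borel_probsD)
  interpret q: prob_space q using q by (rule borel_probsD)
  have le': "emeasure p A \<le> emeasure q A" if "A \<in> sets borel" for A
  proof -
    have "emeasure p A = (INF U\<in>{U. A \<subseteq> U \<and> open U}. emeasure p U)"
      using that borel_probsD[OF p] by (intro outer_regular) auto
    also have "\<dots> \<le> (INF U\<in>{U. A \<subseteq> U \<and> open U}. emeasure q U)"
      using le by (intro INF_mono) auto
    also have "\<dots> = emeasure q A"
      using that borel_probsD[OF q] by (intro outer_regular[symmetric]) auto
    finally show ?thesis .
  qed
  fix A assume "A \<in> sets p"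
  then have A: "A \<in> sets borel" using borel_probsD[OF p] by simp
  then have "measure p (UNIV - A) \<le> measure q (UNIV - A)"
    using le'[of "UNIV - A"] by (simp add: p.emeasure_eq_measure q.emeasure_eq_measure)
  then have "measure q A \<le> measure p A"
    using p.prob_compl[of A] q.prob_compl[of A] A borel_probsD[OF p] borel_probsD[OF q] by auto
  with le'[OF A] show "emeasure p A = emeasure q A"
    by (simp add: p.emeasure_eq_measure q.emeasure_eq_measure)
qed (use borel_probsD[OF p] borel_probsD[OF q] in auto)

section \<open>Disintegration as a randomised map\<close>

text \<open>Ulam's theorem; the rate \<open>4 ^ - j\<close> leaves room for Markov's inequality at level \<open>2 ^ - j\<close>.\<close>

lemma compact_exhaustion:
  fixes \<nu> :: "'a::polish_space measure"
  assumes \<nu>: "\<nu> \<in> borel_probs"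
  obtains K :: "nat \<Rightarrow> 'a set" where "\<And>j. compact (K j)" "\<And>j. measure \<nu> (- K j) \<le> (1/4) ^ j"
proof -
  interpret prob_space \<nu> using \<nu> by (rule borel_probsD)
  have "\<exists>K. compact K \<and> measure \<nu> (- K) \<le> (1/4) ^ j" for j :: nat
  proof -
    have "1 = emeasure \<nu> UNIV" using emeasure_space_1 borel_probsD(3)[OF \<nu>] by simp
    also have "\<dots> = (SUP K\<in>{K. K \<subseteq> UNIV \<and> compact K}. emeasure \<nu> K)"
      using borel_probsD[OF \<nu>] by (intro inner_regular) auto
    finally have one: "(SUP K\<in>{K. K \<subseteq> UNIV \<and> compact K}. emeasure \<nu> K) = 1" ..
    have "ennreal (1 - (1/4) ^ j) < ennreal 1" by (intro ennreal_lessI) auto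
    then have "ennreal (1 - (1/4) ^ j) < (SUP K\<in>{K. K \<subseteq> UNIV \<and> compact K}. emeasure \<nu> K)"
      unfolding one by simp
    then obtain K where K: "compact K" "ennreal (1 - (1/4) ^ j) < emeasure \<nu> K"
      unfolding less_SUP_iff by auto
    have "1 - (1/4) ^ j < measure \<nu> K"
      using K(2) by (simp add: emeasure_eq_measure ennreal_less_iff power_le_one)
    moreover have "measure \<nu> (- K) = 1 - measure \<nu> K"
      using prob_compl[of K] K(1) borel_probsD[OF \<nu>] by (auto simp: Compl_eq_Diff_UNIV compact_imp_closed)
    ultimately show ?thesis using K(1) by auto
  qed
  then show ?thesis using that by metis
qed

text \<open>On the set where \<open>g < f\<close> the integral of \<open>f - g\<close> vanishes.\<close>

lemma AE_le_if_set_nn_integral_le: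
  assumes f[measurable]: "f \<in> borel_measurable M" and g[measurable]: "g \<in> borel_measurable M"
    and fin: "(\<integral>\<^sup>+ x. g x \<partial>M) < \<infinity>"
    and le: "\<And>A. A \<in> sets M \<Longrightarrow> (\<integral>\<^sup>+ x. f x * indicator A x \<partial>M) \<le> (\<integral>\<^sup>+ x. g x * indicator A x \<partial>M)"
  shows "AE x in M. f x \<le> (g x :: ennreal)"
proof -
  define B where "B = {x \<in> space M. g x < f x}"
  have B[measurable]: "B \<in> sets M" unfolding B_def by measurable
  have "(\<integral>\<^sup>+ x. g x * indicator B x \<partial>M) \<le> (\<integral>\<^sup>+ x. g x \<partial>M)"
    by (intro nn_integral_mono) (auto simp: indicator_def)
  with fin have finB: "(\<integral>\<^sup>+ x. g x * indicator B x \<partial>M) \<noteq> \<infinity>" by auto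
  have "(\<integral>\<^sup>+ x. f x * indicator B x - g x * indicator B x \<partial>M)
      = (\<integral>\<^sup>+ x. f x * indicator B x \<partial>M) - (\<integral>\<^sup>+ x. g x * indicator B x \<partial>M)"
    by (rule nn_integral_diff) (use finB in \<open>auto simp: B_def indicator_def\<close>)
  also have "\<dots> = 0"
    using le[OF B] finB by (auto simp: diff_eq_0_iff_ennreal less_top[symmetric] top_unique)
  finally have "AE x in M. f x * indicator B x - g x * indicator B x = 0"
    by (subst (asm) nn_integral_0_iff_AE) auto
  with AE_space show ?thesis
  proof eventually_elim
    case (elim x)
    show ?case
    proof (rule ccontr)
      assume "\<not> f x \<le> g x"
      then have lt: "g x < f x" by simp
      then have "f x - g x = 0" using elim by (simp add: B_def)
      with lt show False by (auto simp: diff_eq_0_iff_ennreal)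
    qed
  qed
qed

text \<open>The uniform distribution on the unit interval, as a measure on all of \<open>\<real>\<close>.\<close>

definition unif :: "real measure" where "unif = uniform_measure lborel {0..1}"

lemma prob_space_unif: "prob_space unif"
  unfolding unif_def by (rule prob_space_uniform_measure) auto

lemma sets_unif[measurable_cong, simp]: "sets unif = sets borel"
  by (simp add: unif_def)

lemma space_unif[simp]: "space unif = UNIV"
  by (simp add: unif_def)

lemma emeasure_unif_below: "emeasure unif {u. ennreal u \<le> y} = min 1 y"
proof -
  have "{u. ennreal u \<le> y} \<in> sets borel" by measurable
  then have "emeasure unif {u. ennreal u \<le> y} = emeasure lborel ({0..1} \<inter> {u. ennreal u \<le> y})"
    unfolding unif_def by (subst emeasure_uniform_measure) (auto simp: divide_ennreal_def)
  also have "\<dots> = min 1 y"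
  proof (cases y)
    case (real a)
    then have "{0..1} \<inter> {u. ennreal u \<le> y} = {0..min 1 a}" by auto
    then show ?thesis using real by (auto simp: min_def)
  next
    case top
    then have "{0..1} \<inter> {u. ennreal u \<le> y} = {0..1}" by auto
    then show ?thesis using top by simp
  qed
  finally show ?thesis .
qed

lemma finite_measure_eq_on_pairs:
  assumes p: "finite_measure p" and s: "sets p = sets (M \<Otimes>\<^sub>M N)" "sets q = sets (M \<Otimes>\<^sub>M N)"
    and eq: "\<And>A B. A \<in> sets M \<Longrightarrow> B \<in> sets N \<Longrightarrow> emeasure p (A \<times> B) = emeasure q (A \<times> B)"
  shows "p = q"
proof (rule measure_eqI_generator_eq[OF Int_stable_pair_measure_generator[of M N], where A="\<lambda>_. space M \<times> space N"])
  interpret finite_measure p by fact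
  show "{a \<times> b |a b. a \<in> sets M \<and> b \<in> sets N} \<subseteq> Pow (space M \<times> space N)"
    by (rule pair_measure_closed)
  show "emeasure p (space M \<times> space N) \<noteq> \<infinity>" for i :: nat by simp
qed (use s eq in \<open>auto simp: sets_pair_measure\<close>)

text \<open>The quantile transform of the conditional distribution of the second coordinate. For every rational
  \<open>q\<close> the density \<open>\<rho> q\<close> of \<open>A \<mapsto> p (A \<times> {q..})\<close> is the conditional probability of \<open>{q..}\<close> given the first
  coordinate, and \<open>\<phi>(x, u)\<close> is the supremum of the \<open>q\<close> with \<open>u \<le> \<rho> q x\<close>. Monotonicity in \<open>q\<close> turns \<open>{t < \<phi>}\<close>
  into an increasing union of sets \<open>{u \<le> \<rho> q x}\<close>, and it can be forced at every point because only
  countably many \<open>q\<close> are involved.\<close>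

lemma randomisation_real:
  fixes p :: "('b::second_countable_topology \<times> real) measure"
  assumes p: "prob_space p" and sp: "sets p = sets (borel \<Otimes>\<^sub>M borel)"
    and supp: "AE z in p. snd z \<in> {0..1}"
  obtains \<phi> :: "'b \<times> real \<Rightarrow> real"
  where "\<phi> \<in> borel_measurable (borel \<Otimes>\<^sub>M borel)"
    "distr (distr p borel fst \<Otimes>\<^sub>M unif) (borel \<Otimes>\<^sub>M borel) (\<lambda>z. (fst z, \<phi> z)) = p"
proof -
  interpret p: prob_space p by fact
  have [measurable_cong]: "sets p = sets (borel \<Otimes>\<^sub>M borel)" by fact
  have space_p: "space p = UNIV" using sets_eq_imp_space_eq[OF sp] by (simp add: space_pair_measure)
  define \<mu> where "\<mu> = distr p borel fst"
  have s\<mu>[measurable_cong, simp]: "sets \<mu> = sets borel" by (simp add: \<mu>_def)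
  have space_\<mu>[simp]: "space \<mu> = UNIV" by (simp add: \<mu>_def)
  interpret \<mu>: prob_space \<mu> unfolding \<mu>_def by (rule p.prob_space_distr) measurable
  interpret U: prob_space unif by (rule prob_space_unif)
  interpret \<mu>U: pair_prob_space \<mu> unif ..
  have rect[measurable]: "A \<times> B \<in> sets p" if "A \<in> sets borel" "B \<in> sets borel" for A B
    unfolding sp using that by auto
  have \<mu>_eq: "emeasure \<mu> A = emeasure p (A \<times> UNIV)" if "A \<in> sets borel" for A
    unfolding \<mu>_def using that by (subst emeasure_distr) (auto simp: space_p intro!: arg_cong[where f="emeasure p"])
  define N where "N q = distr (density p (indicator (UNIV \<times> {q..}))) borel fst" for q :: real
  have N_eq: "emeasure (N q) A = emeasure p (A \<times> {q..})" if A: "A \<in> sets borel" for q A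
  proof -
    have "emeasure (N q) A = emeasure (density p (indicator (UNIV \<times> {q..}))) (A \<times> UNIV)"
      unfolding N_def using A by (subst emeasure_distr) (auto simp: space_p intro!: arg_cong2[where f=emeasure])
    also have "\<dots> = (\<integral>\<^sup>+ z. indicator (A \<times> {q..}) z \<partial>p)"
    proof -
      have "emeasure (density p (indicator (UNIV \<times> {q..}))) (A \<times> UNIV)
          = (\<integral>\<^sup>+ z. indicator (UNIV \<times> {q..}) z * indicator (A \<times> UNIV) z \<partial>p)"
        using A by (intro emeasure_density borel_measurable_indicator rect) auto
      also have "\<dots> = (\<integral>\<^sup>+ z. indicator (A \<times> {q..}) z \<partial>p)"
        by (intro nn_integral_cong) (auto simp: indicator_def)
      finally show ?thesis .
    qed
    also have "\<dots> = emeasure p (A \<times> {q..})"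
      using A by (intro nn_integral_indicator rect) auto
    finally show ?thesis .
  qed
  define \<rho> where "\<rho> q = RN_deriv \<mu> (N q)" for q
  have [measurable]: "\<rho> q \<in> borel_measurable borel" for q
    using borel_measurable_RN_deriv[of \<mu> "N q"] unfolding \<rho>_def by (simp cong: measurable_cong_sets)
  have dens: "density \<mu> (\<rho> q) = N q" for q
    unfolding \<rho>_def
  proof (rule \<mu>.density_RN_deriv)
    show "absolutely_continuous \<mu> (N q)"
      unfolding absolutely_continuous_def
    proof
      fix A assume "A \<in> null_sets \<mu>"
      then have "A \<in> sets borel" "emeasure \<mu> A = 0" by auto
      then have A: "A \<in> sets borel" "emeasure p (A \<times> UNIV) = 0" by (simp_all add: \<mu>_eq)
      have "emeasure p (A \<times> {q..}) \<le> emeasure p (A \<times> UNIV)"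
        using A by (intro emeasure_mono) auto
      with A show "A \<in> null_sets (N q)" by (simp add: null_sets_def N_eq) (simp add: N_def)
    qed
  qed (simp add: N_def)
  have int\<rho>: "(\<integral>\<^sup>+ x. \<rho> q x * indicator A x \<partial>\<mu>) = emeasure p (A \<times> {q..})" if A: "A \<in> sets borel" for q A
    using A by (simp add: emeasure_density[symmetric] dens N_eq)
  have fin\<rho>: "(\<integral>\<^sup>+ x. \<rho> q x \<partial>\<mu>) < \<infinity>" for q
    using int\<rho>[of UNIV q] by (simp add: less_top[symmetric])
  have \<rho>_mono: "AE x in \<mu>. \<rho> q' x \<le> \<rho> q x" if "q \<le> q'" for q q'
  proof (rule AE_le_if_set_nn_integral_le)
    fix A assume "A \<in> sets \<mu>"
    then show "(\<integral>\<^sup>+ x. \<rho> q' x * indicator A x \<partial>\<mu>) \<le> (\<integral>\<^sup>+ x. \<rho> q x * indicator A x \<partial>\<mu>)"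
      using that by (auto simp: int\<rho> intro!: emeasure_mono)
  qed (use fin\<rho> in auto)
  have \<rho>_le1: "AE x in \<mu>. \<rho> q x \<le> 1" for q
  proof (rule AE_le_if_set_nn_integral_le)
    fix A assume "A \<in> sets \<mu>"
    then show "(\<integral>\<^sup>+ x. \<rho> q x * indicator A x \<partial>\<mu>) \<le> (\<integral>\<^sup>+ x. 1 * indicator A x \<partial>\<mu>)"
      by (auto simp: int\<rho> \<mu>_eq intro!: emeasure_mono)
  qed (auto simp: \<mu>.emeasure_space_1[simplified])
  define D where "D = (\<rat> \<inter> {0..1} :: real set)"
  have cD: "countable D" unfolding D_def using countable_rat by auto
  \<comment> \<open>a version of the densities that is antitone in \<open>q\<close> at every point\<close>
  define \<rho>' where "\<rho>' q x = (SUP q'\<in>D \<inter> {q..}. \<rho> q' x)" for q x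
  have \<rho>'_meas[measurable]: "\<rho>' q \<in> borel_measurable borel" for q
    unfolding \<rho>'_def using cD by (intro borel_measurable_SUP) auto
  have \<rho>'_eq: "AE x in \<mu>. \<rho>' q x = \<rho> q x" if "q \<in> D" for q
  proof -
    have "AE x in \<mu>. \<forall>q'\<in>D \<inter> {q..}. \<rho> q' x \<le> \<rho> q x"
      using cD \<rho>_mono by (subst AE_ball_countable) auto
    then show ?thesis
    proof eventually_elim
      case (elim x)
      then show ?case unfolding \<rho>'_def using that by (intro antisym SUP_least SUP_upper) auto
    qed
  qed
  have \<rho>'_antimono: "\<rho>' q' x \<le> \<rho>' q x" if "q \<le> q'" for q q' x
    unfolding \<rho>'_def using that by (intro SUP_subset_mono) auto
  \<comment> \<open>inserting \<open>0\<close> makes the set nonempty; \<open>0\<close> is harmless as the second coordinate is nonnegative\<close>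
  define S where "S z = insert 0 {q\<in>D. ennreal (snd z) \<le> \<rho>' q (fst z)}" for z :: "'b \<times> real"
  define \<phi> where "\<phi> z = Sup (S z)" for z
  have S: "S z \<noteq> {}" "bdd_above (S z)" for z
    by (auto simp: S_def D_def intro!: bdd_aboveI[of _ 1])
  have \<phi>_gr: "t < \<phi> z \<longleftrightarrow> t < 0 \<or> (\<exists>q\<in>D \<inter> {t<..}. ennreal (snd z) \<le> \<rho>' q (fst z))" for t z
    unfolding \<phi>_def less_cSup_iff[OF S] by (auto simp: S_def)
  have \<phi>_meas[measurable]: "\<phi> \<in> borel_measurable (borel \<Otimes>\<^sub>M borel)"
  proof (rule borel_measurableI_greater)
    fix t
    have "{z \<in> space (borel \<Otimes>\<^sub>M borel). t < \<phi> z} = (if t < 0 then space (borel \<Otimes>\<^sub>M borel) else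
       (\<Union>q\<in>D \<inter> {t<..}. {z \<in> space (borel \<Otimes>\<^sub>M borel). ennreal (snd z) \<le> \<rho>' q (fst z)}))"
      by (auto simp: \<phi>_gr)
    also have "\<dots> \<in> sets (borel \<Otimes>\<^sub>M borel)"
    proof -
      have "{z \<in> space (borel \<Otimes>\<^sub>M borel). ennreal (snd z) \<le> \<rho>' q (fst z)} \<in> sets (borel \<Otimes>\<^sub>M borel)" for q
        by measurable
      then show ?thesis using cD by (auto intro!: sets.countable_UN')
    qed
    finally show "{z \<in> space (borel \<Otimes>\<^sub>M borel). t < \<phi> z} \<in> sets (borel \<Otimes>\<^sub>M borel)" .
  qed
  have level: "emeasure (\<mu> \<Otimes>\<^sub>M unif) {z. fst z \<in> A \<and> ennreal (snd z) \<le> \<rho>' q (fst z)} = emeasure p (A \<times> {q..})"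
    if A[measurable]: "A \<in> sets borel" and q: "q \<in> D" for A q
  proof -
    have "{z \<in> space (\<mu> \<Otimes>\<^sub>M unif). fst z \<in> A \<and> ennreal (snd z) \<le> \<rho>' q (fst z)} \<in> sets (\<mu> \<Otimes>\<^sub>M unif)"
      by measurable
    then have "{z. fst z \<in> A \<and> ennreal (snd z) \<le> \<rho>' q (fst z)} \<in> sets (\<mu> \<Otimes>\<^sub>M unif)"
      by (simp add: space_pair_measure)
    then have "emeasure (\<mu> \<Otimes>\<^sub>M unif) {z. fst z \<in> A \<and> ennreal (snd z) \<le> \<rho>' q (fst z)}
      = (\<integral>\<^sup>+ x. emeasure unif (Pair x -` {z. fst z \<in> A \<and> ennreal (snd z) \<le> \<rho>' q (fst z)}) \<partial>\<mu>)"
      by (rule U.emeasure_pair_measure_alt)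
    also have "\<dots> = (\<integral>\<^sup>+ x. \<rho> q x * indicator A x \<partial>\<mu>)"
    proof (rule nn_integral_cong_AE)
      show "AE x in \<mu>. emeasure unif (Pair x -` {z. fst z \<in> A \<and> ennreal (snd z) \<le> \<rho>' q (fst z)}) = \<rho> q x * indicator A x"
        using \<rho>_le1[of q] \<rho>'_eq[OF q]
      proof eventually_elim
        case (elim x)
        then show ?case
          using emeasure_unif_below[of "\<rho> q x"] by (cases "x \<in> A") (auto simp: vimage_def min_def)
      qed
    qed
    also have "\<dots> = emeasure p (A \<times> {q..})" using A by (rule int\<rho>)
    finally show ?thesis .
  qed
  define P where "P = distr (\<mu> \<Otimes>\<^sub>M unif) (borel \<Otimes>\<^sub>M borel) (\<lambda>z. (fst z, \<phi> z))"
  have P_eq: "emeasure P (A \<times> B) = emeasure (\<mu> \<Otimes>\<^sub>M unif) {z. fst z \<in> A \<and> \<phi> z \<in> B}"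
    if "A \<in> sets borel" "B \<in> sets borel" for A B
    unfolding P_def using that
    by (subst emeasure_distr) (auto simp: space_pair_measure intro!: arg_cong[where f="emeasure _"])
  have tails: "emeasure P (A \<times> {t<..}) = emeasure p (A \<times> {t<..})" if A[measurable]: "A \<in> sets borel" for A t
  proof -
    consider "t < 0" | "0 \<le> t" "t < 1" | "1 \<le> t" by linarith
    then show ?thesis
    proof cases
      case 1
      then have "emeasure P (A \<times> {t<..}) = emeasure (\<mu> \<Otimes>\<^sub>M unif) (A \<times> UNIV)"
        using A by (auto simp: P_eq \<phi>_gr intro!: arg_cong[where f="emeasure _"])
      also have "\<dots> = emeasure \<mu> A"
        using A U.emeasure_space_1 by (subst U.emeasure_pair_measure_Times) auto
      also have "\<dots> = emeasure p (A \<times> {t<..})"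
        unfolding \<mu>_eq[OF A]
      proof (rule emeasure_eq_AE)
        show "AE z in p. z \<in> A \<times> UNIV \<longleftrightarrow> z \<in> A \<times> {t<..}"
          using supp by eventually_elim (use 1 in auto)
      qed (use A in auto)
      finally show ?thesis .
    next
      case 3
      then have "D \<inter> {t<..} = {}" by (auto simp: D_def)
      then have "emeasure P (A \<times> {t<..}) = 0"
        using A 3 by (simp add: P_eq \<phi>_gr)
      moreover have "emeasure p (A \<times> {t<..}) = emeasure p {}"
      proof (rule emeasure_eq_AE)
        show "AE z in p. z \<in> A \<times> {t<..} \<longleftrightarrow> z \<in> {}"
          using supp by eventually_elim (use 3 in auto)
      qed (use A in auto)
      ultimately show ?thesis by simp
    next
      case 2
      define e where "e = from_nat_into (D \<inter> {t<..})"
      have "1 \<in> D \<inter> {t<..}" using 2 by (simp add: D_def)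
      then have ne: "D \<inter> {t<..} \<noteq> {}" by blast
      have re: "range e = D \<inter> {t<..}"
        unfolding e_def by (rule range_from_nat_into[OF ne]) (use cD in auto)
      \<comment> \<open>a decreasing sequence in \<open>D\<close> with limit \<open>t\<close>, so that the events \<open>V k\<close> increase\<close>
      define m where "m k = Min (e ` {..k})" for k :: nat
      have m_in: "m k \<in> D \<inter> {t<..}" for k
      proof -
        have "m k \<in> e ` {..k}" unfolding m_def by (intro Min_in) auto
        then show ?thesis using re by auto
      qed
      have m_le: "m k \<le> e k" for k unfolding m_def by (intro Min_le) auto
      have m_dec: "m k' \<le> m k" if "k \<le> k'" for k k'
        unfolding m_def using that by (intro Min_antimono) auto
      define V where "V k = {z. fst z \<in> A \<and> ennreal (snd z) \<le> \<rho>' (m k) (fst z)}" for k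
      have V_meas: "V k \<in> sets (\<mu> \<Otimes>\<^sub>M unif)" for k
      proof -
        have "{z \<in> space (\<mu> \<Otimes>\<^sub>M unif). fst z \<in> A \<and> ennreal (snd z) \<le> \<rho>' (m k) (fst z)} \<in> sets (\<mu> \<Otimes>\<^sub>M unif)"
          by measurable
        then show ?thesis by (simp add: space_pair_measure V_def)
      qed
      have "incseq V"
        unfolding incseq_def V_def using \<rho>'_antimono[OF m_dec] by (auto intro: order_trans)
      have "{z. fst z \<in> A \<and> \<phi> z \<in> {t<..}} = (\<Union>k. V k)"
      proof (intro equalityI subsetI)
        fix z assume "z \<in> {z. fst z \<in> A \<and> \<phi> z \<in> {t<..}}"
        then obtain q where q: "fst z \<in> A" "q \<in> D \<inter> {t<..}" "ennreal (snd z) \<le> \<rho>' q (fst z)"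
          using 2 by (auto simp: \<phi>_gr)
        then obtain k where "q = e k" using re by (metis imageE)
        then have "\<rho>' q (fst z) \<le> \<rho>' (m k) (fst z)" using m_le by (intro \<rho>'_antimono) auto
        with q show "z \<in> (\<Union>k. V k)" by (auto simp: V_def intro: order_trans)
      next
        fix z assume "z \<in> (\<Union>k. V k)"
        then show "z \<in> {z. fst z \<in> A \<and> \<phi> z \<in> {t<..}}"
          using m_in unfolding V_def mem_Collect_eq \<phi>_gr greaterThan_iff by blast
      qed
      then have "emeasure P (A \<times> {t<..}) = (SUP k. emeasure (\<mu> \<Otimes>\<^sub>M unif) (V k))"
        using A V_meas \<open>incseq V\<close> by (simp add: P_eq SUP_emeasure_incseq[symmetric] image_subset_iff)
      also have "\<dots> = (SUP k. emeasure p (A \<times> {m k..}))"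
        unfolding V_def using level[OF A] m_in by simp
      also have "\<dots> = emeasure p (\<Union>k. A \<times> {m k..})"
      proof (rule SUP_emeasure_incseq)
        show "incseq (\<lambda>k. A \<times> {m k..})"
          unfolding incseq_def using m_dec by (fastforce intro: order_trans)
      qed (use A in auto)
      also have "\<dots> = emeasure p (A \<times> {t<..})"
      proof (rule emeasure_eq_AE)
        show "AE z in p. z \<in> (\<Union>k. A \<times> {m k..}) \<longleftrightarrow> z \<in> A \<times> {t<..}"
          using supp
        proof eventually_elim
          case (elim z)
          show ?case
          proof
            assume "z \<in> (\<Union>k. A \<times> {m k..})"
            then obtain k where "z \<in> A \<times> {m k..}" by auto
            then show "z \<in> A \<times> {t<..}" using m_in[of k] by (auto simp: mem_Times_iff)
          next
            assume z: "z \<in> A \<times> {t<..}"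
            then have "t < snd z" by auto
            then obtain q where q: "q \<in> \<rat>" "t < q" "q < snd z" using Rats_dense_in_real by blast
            then have "q \<in> D \<inter> {t<..}" using 2 elim by (auto simp: D_def)
            then obtain k where "q = e k" using re by (metis imageE)
            then have "m k \<le> snd z" using q m_le[of k] by simp
            with z show "z \<in> (\<Union>k. A \<times> {m k..})" by (auto simp: mem_Times_iff)
          qed
        qed
      qed (use A in auto)
      finally show ?thesis .
    qed
  qed
  have sP: "sets P = sets (borel \<Otimes>\<^sub>M borel)" by (simp add: P_def)
  interpret P: prob_space P
    unfolding P_def by (rule \<mu>U.prob_space_distr) measurable
  have "P = p"
  proof (rule finite_measure_eq_on_pairs)
    show "finite_measure P" by (rule P.finite_measure_axioms)
    fix A :: "'b set" and B :: "real set" assume A: "A \<in> sets borel" and B: "B \<in> sets borel"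
    define R where "R r = distr (restrict_space r (A \<times> UNIV)) borel snd" for r :: "('b \<times> real) measure"
    have R_eq: "emeasure (R r) B = emeasure r (A \<times> B)"
      if r: "sets r = sets (borel \<Otimes>\<^sub>M borel)" and B: "B \<in> sets borel" for r B
    proof -
      have [simp]: "space r = UNIV" using sets_eq_imp_space_eq[OF r] by (simp add: space_pair_measure)
      have AU: "A \<times> UNIV \<in> sets r" unfolding r using A by auto
      have "snd \<in> measurable r borel" unfolding measurable_cong_sets[OF r refl] by measurable
      then have "snd \<in> measurable (restrict_space r (A \<times> UNIV)) borel"
        by (rule measurable_restrict_space1)
      then have "emeasure (R r) B = emeasure (restrict_space r (A \<times> UNIV)) (A \<times> B)"
        unfolding R_def using B
        by (subst emeasure_distr) (auto simp: space_restrict_space intro!: arg_cong[where f="emeasure _"])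
      also have "\<dots> = emeasure r (A \<times> B)"
        using AU by (intro emeasure_restrict_space) auto
      finally show ?thesis .
    qed
    have "R P = R p"
    proof (rule measure_eqI_lessThan)
      show "emeasure (R P) {x<..} < \<infinity>" for x
        by (simp add: R_eq[OF sP] less_top[symmetric])
      show "emeasure (R P) {x<..} = emeasure (R p) {x<..}" for x
        using tails[OF A] by (simp add: R_eq[OF sP] R_eq[OF sp])
    qed (auto simp: R_def)
    then show "emeasure P (A \<times> B) = emeasure p (A \<times> B)"
      using R_eq[OF sP B] R_eq[OF sp B] by simp
  qed (use sP sp in auto)
  then show ?thesis
    using that[OF \<phi>_meas] unfolding P_def \<mu>_def by simp
qed

text \<open>Coding the second coordinate reduces a general space to the real line: the decoding map is a left
  inverse of the code on a countable union of compact sets of full measure.\<close>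

lemma randomisation:
  fixes p :: "('b::second_countable_topology \<times> 'a::polish_space) measure"
  assumes p: "p \<in> borel_probs"
  obtains \<phi> :: "'b \<times> real \<Rightarrow> 'a"
  where "\<phi> \<in> borel_measurable (borel \<Otimes>\<^sub>M borel)"
    "distr (distr p borel fst \<Otimes>\<^sub>M unif) borel (\<lambda>z. (fst z, \<phi> z)) = p"
proof -
  interpret p: prob_space p using p by (rule borel_probsD)
  have sp[measurable_cong]: "sets p = sets (borel \<Otimes>\<^sub>M borel)"
    using borel_probsD(2)[OF p] unfolding borel_prod .
  define \<nu> where "\<nu> = distr p borel snd"
  have \<nu>: "\<nu> \<in> borel_probs"
    unfolding \<nu>_def using p by (rule distr_borel_probs) (simp add: borel_prod[symmetric])
  interpret \<nu>: prob_space \<nu> using \<nu> by (rule borel_probsD)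
  obtain K where K: "\<And>j. compact (K j)" "\<And>j. measure \<nu> (- K j) \<le> (1/4) ^ j"
    using compact_exhaustion[OF \<nu>] by blast
  obtain s :: "'a \<Rightarrow> real" and r where s[measurable]: "s \<in> borel_measurable borel" and s01: "\<And>y. s y \<in> {0..1}"
    and r[measurable]: "r \<in> borel_measurable borel"
    and code: "\<And>j A. compact A \<Longrightarrow> A \<subseteq> K j \<Longrightarrow> \<exists>C. closed C \<and> s ` A \<subseteq> C \<and> r ` C \<subseteq> A"
    using borel_coding[of K, OF K(1)] by metis
  have rs: "r (s y) = y" if "y \<in> K j" for y j
    using code[of "{y}" j] that by auto
  have "AE y in \<nu>. y \<in> (\<Union>j. K j)"
  proof -
    have KU: "(\<Union>j. K j) \<in> sets borel" using K(1) by (auto simp: compact_imp_closed)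
    have "measure \<nu> (- (\<Union>j. K j)) \<le> (1/4) ^ j" for j
    proof -
      have "measure \<nu> (- (\<Union>j. K j)) \<le> measure \<nu> (- K j)"
        using K(1)[of j] borel_probsD[OF \<nu>] by (intro \<nu>.finite_measure_mono) (auto simp: compact_imp_closed)
      also note K(2)
      finally show ?thesis .
    qed
    moreover have "(\<lambda>j. (1/4::real) ^ j) \<longlonglongrightarrow> 0" by (intro LIMSEQ_realpow_zero) auto
    ultimately have "measure \<nu> (- (\<Union>j. K j)) \<le> 0" by (intro LIMSEQ_le_const) auto
    then have "measure \<nu> (- (\<Union>j. K j)) = 0" by (simp add: measure_le_0_iff)
    moreover have "- (\<Union>j. K j) \<in> sets borel" using KU by (rule borel_comp)
    ultimately have "- (\<Union>j. K j) \<in> null_sets \<nu>"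
      using borel_probsD[OF \<nu>] unfolding null_sets_def by (simp add: \<nu>.emeasure_eq_measure)
    then show ?thesis by (rule AE_not_in[THEN AE_mp]) auto
  qed
  then have "AE y in \<nu>. r (s y) = y"
    by eventually_elim (use rs in blast)
  then have rs_AE: "AE z in p. r (s (snd z)) = snd z"
    unfolding \<nu>_def by (subst (asm) AE_distr_iff) auto
  define p' where "p' = distr p (borel \<Otimes>\<^sub>M borel) (\<lambda>z. (fst z, s (snd z)))"
  have "prob_space p'" unfolding p'_def by (rule p.prob_space_distr) measurable
  moreover have "AE z in p'. snd z \<in> {0..1}"
    unfolding p'_def using s01 by (subst AE_distr_iff) auto
  ultimately obtain \<phi> :: "'b \<times> real \<Rightarrow> real" where \<phi>[measurable]: "\<phi> \<in> borel_measurable (borel \<Otimes>\<^sub>M borel)"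
    and law: "distr (distr p' borel fst \<Otimes>\<^sub>M unif) (borel \<Otimes>\<^sub>M borel) (\<lambda>z. (fst z, \<phi> z)) = p'"
    using randomisation_real[of p'] by (auto simp: p'_def)
  have fst_p': "distr p' borel fst = distr p borel fst"
    unfolding p'_def by (subst distr_distr) (auto simp: o_def)
  have "distr (distr p borel fst \<Otimes>\<^sub>M unif) borel (\<lambda>z. (fst z, r (\<phi> z)))
      = distr (distr (distr p borel fst \<Otimes>\<^sub>M unif) (borel \<Otimes>\<^sub>M borel) (\<lambda>z. (fst z, \<phi> z))) borel (\<lambda>z. (fst z, r (snd z)))"
    by (subst distr_distr) (auto simp: o_def borel_prod[symmetric])
  also have "\<dots> = distr p borel (\<lambda>z. (fst z, r (s (snd z))))"
    unfolding law[unfolded fst_p'] unfolding p'_def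
    by (subst distr_distr) (auto simp: o_def borel_prod[symmetric])
  also have "\<dots> = distr p p (\<lambda>z. z)"
    using rs_AE sp by (intro distr_cong_AE) (auto simp: borel_prod[symmetric])
  also have "\<dots> = p" by (rule distr_id2) simp
  finally show ?thesis by (intro that[of "r \<circ> \<phi>"]) (auto simp: o_def)
qed

section \<open>Empirical measures of independent samples and extended expectations\<close>

lemma empirical_eq_distr:
  assumes "1 \<le> n"
  shows "empirical n y = distr (measure_pmf (pmf_of_set {1..n})) borel y"
proof (rule measure_eqI)
  fix A assume "A \<in> sets (empirical n y)"
  then have A: "A \<in> sets borel" by simp
  have ne: "{1..n} \<noteq> {}" using assms by auto
  have "emeasure (distr (measure_pmf (pmf_of_set {1..n})) borel y) A
    = emeasure (measure_pmf (pmf_of_set {1..n})) (y -` A)"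
    using A by (subst emeasure_distr) auto
  also have "\<dots> = ennreal (card ({1..n} \<inter> y -` A) / n)"
    using ne by (simp add: emeasure_pmf_of_set)
  also have "\<dots> = ennreal (1 / real n) * ennreal (card ({1..n} \<inter> y -` A))"
    by (subst ennreal_mult[symmetric]) auto
  also have "ennreal (card ({1..n} \<inter> y -` A)) = (\<Sum>i = 1..n. indicator A (y i))"
    by (simp add: indicator_def of_bool_def sum.If_cases vimage_def ennreal_of_nat_eq_real_of_nat)
  finally show "emeasure (empirical n y) A = emeasure (distr (measure_pmf (pmf_of_set {1..n})) borel y) A"
    using A by (simp add: emeasure_empirical)
qed simp

lemma nn_integral_empirical:
  assumes n: "1 \<le> n" and f: "f \<in> borel_measurable borel"
  shows "(\<integral>\<^sup>+ x. f x \<partial>empirical n y) = ennreal (1 / real n) * (\<Sum>i = 1..n. f (y i))"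
proof -
  have ne: "{1..n} \<noteq> {}" using n by auto
  have "(\<integral>\<^sup>+ x. f x \<partial>empirical n y) = (\<integral>\<^sup>+ i. f (y i) \<partial>measure_pmf (pmf_of_set {1..n}))"
    unfolding empirical_eq_distr[OF n] using f by (subst nn_integral_distr) auto
  also have "\<dots> = (\<Sum>i = 1..n. f (y i)) / ennreal (real n)"
    using ne by (simp add: nn_integral_pmf_of_set ennreal_of_nat_eq_real_of_nat)
  also have "\<dots> = ennreal (1 / real n) * (\<Sum>i = 1..n. f (y i))"
    using n by (simp add: divide_ennreal_def inverse_ennreal inverse_eq_divide mult.commute)
  finally show ?thesis .
qed

lemma distr_empirical:
  assumes n: "1 \<le> n" and f: "f \<in> borel_measurable borel"
  shows "distr (empirical n y) borel f = empirical n (\<lambda>i. f (y i))"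
  unfolding empirical_eq_distr[OF n] using f by (subst distr_distr) (auto simp: o_def)

lemma measure_empirical:
  assumes n: "1 \<le> n" and A: "A \<in> sets borel"
  shows "measure (empirical n y) A = (\<Sum>i = 1..n. indicator A (y i)) / real n"
proof -
  have "emeasure (empirical n y) A = ennreal ((\<Sum>i = 1..n. indicator A (y i)) / real n)"
  proof -
    have "emeasure (empirical n y) A = ennreal (1 / real n) * (\<Sum>i = 1..n. ennreal (indicator A (y i)))"
      using A by (simp add: emeasure_empirical ennreal_indicator)
    also have "\<dots> = ennreal (1 / real n * (\<Sum>i = 1..n. indicator A (y i)))"
      by (subst sum_ennreal) (simp_all add: ennreal_mult[symmetric] sum_nonneg del: One_nat_def)
    finally show ?thesis by simp
  qed
  then show ?thesis by (simp add: measure_def sum_nonneg)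
qed

text \<open>Hoeffding's inequality for the indicators of \<open>A\<close> along the sample.\<close>

lemma empirical_deviation:
  fixes X :: "nat \<Rightarrow> 'b \<Rightarrow> 'a::topological_space"
  assumes M: "prob_space M" and indep: "prob_space.indep_vars M (\<lambda>_. borel) X {1..n}"
    and law: "\<And>i. i \<in> {1..n} \<Longrightarrow> distr M borel (X i) = \<nu>"
    and n: "1 \<le> n" and A[measurable]: "A \<in> sets borel" and \<delta>: "0 < \<delta>"
  shows "measure M {\<omega> \<in> space M. \<delta> \<le> \<bar>measure (empirical n (\<lambda>i. X i \<omega>)) A - measure \<nu> A\<bar>}
      \<le> 2 * exp (- 2 * real n * \<delta>\<^sup>2)"
proof -
  interpret prob_space M by fact
  have X[measurable]: "X i \<in> borel_measurable M" if "i \<in> {1..n}" for i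
    using indep that unfolding indep_vars_def by auto
  define Z where "Z i \<omega> = (indicator A (X i \<omega>) :: real)" for i \<omega>
  have one: "1 \<in> {1..n}" using n by simp
  have Zd: "distr M borel (Z i) = distr \<nu> borel (indicator A :: _ \<Rightarrow> real)" if "i \<in> {1..n}" for i
    unfolding law[OF that, symmetric] Z_def[abs_def] using X[OF that]
    by (subst distr_distr) (auto simp: o_def)
  \<comment> \<open>a separate name keeps the rule \<open>expectation (Z i) = expectation W\<close> from rewriting \<open>Z 1\<close> to itself\<close>
  define W where "W = Z 1"
  interpret Hoeffding_ineq_iid M "{1..n}" Z W 0 1 "expectation W"
  proof unfold_locales
    show "indep_vars (\<lambda>_. borel) Z {1..n}"
      unfolding Z_def by (rule indep_vars_compose2[OF indep]) auto
    show "distr M borel (Z i) = distr M borel W" if "i \<in> {1..n}" for i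
      using Zd[OF that] Zd[OF one] by (simp add: W_def)
    show "random_variable borel W" unfolding W_def Z_def[abs_def] using X[OF one] by measurable
    show "AE x in M. W x \<in> {0..1}" by (auto simp: W_def Z_def indicator_def)
  qed auto
  have "expectation W = (LINT x|distr M borel (X 1). indicator A x)"
    unfolding W_def Z_def[abs_def] using X[OF one] by (subst integral_distr) auto
  also have "\<dots> = measure \<nu> A" using A by (simp add: law[OF one, symmetric])
  finally have E: "expectation W = measure \<nu> A" .
  show ?thesis
    using Hoeffding_ineq_abs_ge'[of \<delta>] \<delta> n
    by (simp add: E measure_empirical[OF n A] Z_def)
qed

lemma empirical_deviation_finite:
  fixes X :: "nat \<Rightarrow> 'b \<Rightarrow> 'a::topological_space"
  assumes M: "prob_space M" and indep: "prob_space.indep_vars M (\<lambda>_. borel) X {1..n}"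
    and law: "\<And>i. i \<in> {1..n} \<Longrightarrow> distr M borel (X i) = \<nu>"
    and n: "1 \<le> n" and U: "\<And>i. U i \<in> sets borel" and \<delta>: "0 < \<delta>"
  shows "{\<omega> \<in> space M. \<exists>i<m::nat. \<delta> \<le> \<bar>measure (empirical n (\<lambda>i. X i \<omega>)) (U i) - measure \<nu> (U i)\<bar>} \<in> sets M"
    and "measure M {\<omega> \<in> space M. \<exists>i<m. \<delta> \<le> \<bar>measure (empirical n (\<lambda>i. X i \<omega>)) (U i) - measure \<nu> (U i)\<bar>}
      \<le> real m * (2 * exp (- 2 * real n * \<delta>\<^sup>2))"
proof -
  interpret prob_space M by fact
  have X: "X i \<in> borel_measurable M" if "i \<in> {1..n}" for i
    using indep that unfolding indep_vars_def by auto
  define B where "B i = {\<omega> \<in> space M. \<delta> \<le> \<bar>measure (empirical n (\<lambda>i. X i \<omega>)) (U i) - measure \<nu> (U i)\<bar>}" for i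
  have meas: "B i \<in> sets M" for i
  proof -
    have "(\<lambda>\<omega>. \<Sum>j = 1..n. indicator (U i) (X j \<omega>) :: real) \<in> borel_measurable M"
      using X U by (intro borel_measurable_sum measurable_compose[OF X borel_measurable_indicator]) auto
    then show ?thesis unfolding B_def measure_empirical[OF n U] by measurable
  qed
  have eq: "{\<omega> \<in> space M. \<exists>i<m. \<delta> \<le> \<bar>measure (empirical n (\<lambda>i. X i \<omega>)) (U i) - measure \<nu> (U i)\<bar>} = (\<Union>i<m. B i)"
    by (auto simp: B_def)
  show "{\<omega> \<in> space M. \<exists>i<m::nat. \<delta> \<le> \<bar>measure (empirical n (\<lambda>i. X i \<omega>)) (U i) - measure \<nu> (U i)\<bar>} \<in> sets M"
    unfolding eq using meas by auto
  have "measure M (\<Union>i<m. B i) \<le> (\<Sum>i<m. measure M (B i))"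
    using meas by (intro finite_measure_subadditive_finite) auto
  also have "\<dots> \<le> (\<Sum>i<m. 2 * exp (- 2 * real n * \<delta>\<^sup>2))"
    unfolding B_def using U by (intro sum_mono empirical_deviation assms)
  finally show "measure M {\<omega> \<in> space M. \<exists>i<m. \<delta> \<le> \<bar>measure (empirical n (\<lambda>i. X i \<omega>)) (U i) - measure \<nu> (U i)\<bar>}
      \<le> real m * (2 * exp (- 2 * real n * \<delta>\<^sup>2))"
    unfolding eq by simp
qed

lemma deviation_bound_tendsto_0:
  assumes "0 < \<delta>"
  shows "(\<lambda>n. real m * (2 * exp (- 2 * real n * \<delta>\<^sup>2))) \<longlonglongrightarrow> 0"
proof -
  have "(\<lambda>n. real m * (2 * (exp (- 2 * \<delta>\<^sup>2)) ^ n)) \<longlonglongrightarrow> real m * (2 * 0)"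
    using assms by (intro tendsto_mult tendsto_const LIMSEQ_realpow_zero) auto
  then show ?thesis by (simp add: exp_of_nat_mult[symmetric] mult_ac)
qed

text \<open>Stated for arbitrary functions, so that the random payoff can be compared with simpler measurable random
  variables although \<open>F\<close> is only known to be continuous for the weak topology.\<close>

lemma ereal_expectation_mono:
  assumes "AE \<omega> in M. f \<omega> \<le> g \<omega>"
  shows "ereal_expectation M f \<le> ereal_expectation M g"
  unfolding ereal_expectation_def
proof (rule ereal_minus_mono)
  have "(\<integral>\<^sup>+ \<omega>. e2ennreal (f \<omega>) \<partial>M) \<le> (\<integral>\<^sup>+ \<omega>. e2ennreal (g \<omega>) \<partial>M)"
    by (rule nn_integral_mono_AE) (use assms in \<open>auto elim!: eventually_mono intro: e2ennreal_mono\<close>)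
  then show "enn2ereal (\<integral>\<^sup>+ \<omega>. e2ennreal (f \<omega>) \<partial>M) \<le> enn2ereal (\<integral>\<^sup>+ \<omega>. e2ennreal (g \<omega>) \<partial>M)"
    by (simp add: less_eq_ennreal.rep_eq)
  have "(\<integral>\<^sup>+ \<omega>. e2ennreal (- g \<omega>) \<partial>M) \<le> (\<integral>\<^sup>+ \<omega>. e2ennreal (- f \<omega>) \<partial>M)"
    by (rule nn_integral_mono_AE) (use assms in \<open>auto elim!: eventually_mono intro: e2ennreal_mono\<close>)
  then show "enn2ereal (\<integral>\<^sup>+ \<omega>. e2ennreal (- g \<omega>) \<partial>M) \<le> enn2ereal (\<integral>\<^sup>+ \<omega>. e2ennreal (- f \<omega>) \<partial>M)"
    by (simp add: less_eq_ennreal.rep_eq)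
qed

lemma ereal_expectation_real:
  assumes h: "integrable M h"
  shows "ereal_expectation M (\<lambda>\<omega>. ereal (h \<omega>)) = ereal (LINT \<omega>|M. h \<omega>)"
proof -
  have fin: "(\<integral>\<^sup>+ \<omega>. ennreal (h \<omega>) \<partial>M) < top" "(\<integral>\<^sup>+ \<omega>. ennreal (- h \<omega>) \<partial>M) < top"
    using h unfolding real_integrable_def by (auto simp: less_top)
  have e: "enn2ereal x = ereal (enn2real x)" if "x < top" for x
    using that by (cases x) (auto simp: enn2ereal_ennreal)
  show ?thesis
    unfolding ereal_expectation_def uminus_ereal.simps e2ennreal_ereal
    by (subst real_lebesgue_integral_def[OF h]) (simp add: e[OF fin(1)] e[OF fin(2)])
qed

lemma ereal_expectation_const_minus:
  assumes M: "prob_space M" and k: "k \<in> borel_measurable M" and fin: "(\<integral>\<^sup>+ \<omega>. k \<omega> \<partial>M) < \<infinity>"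
  shows "ereal_expectation M (\<lambda>\<omega>. ereal b - enn2ereal (k \<omega>)) = ereal b - enn2ereal (\<integral>\<^sup>+ \<omega>. k \<omega> \<partial>M)"
proof -
  interpret prob_space M by fact
  define h where "h \<omega> = enn2real (k \<omega>)" for \<omega>
  have ae: "AE \<omega> in M. k \<omega> = ennreal (h \<omega>)"
    using nn_integral_noteq_infinite[OF k] fin
    by (auto simp: h_def less_top elim!: eventually_mono)
  have nn: "0 \<le> h \<omega>" for \<omega> by (simp add: h_def)
  have hm[measurable]: "h \<in> borel_measurable M" unfolding h_def[abs_def] using k by measurable
  have eq: "(\<integral>\<^sup>+ \<omega>. k \<omega> \<partial>M) = (\<integral>\<^sup>+ \<omega>. ennreal (h \<omega>) \<partial>M)"
    by (intro nn_integral_cong_AE ae)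
  have hi: "integrable M h"
    using fin eq nn by (intro integrableI_nonneg) auto
  have "ereal_expectation M (\<lambda>\<omega>. ereal b - enn2ereal (k \<omega>)) = ereal_expectation M (\<lambda>\<omega>. ereal (b - h \<omega>))"
    using ae nn by (intro antisym ereal_expectation_mono)
      (auto elim!: eventually_mono simp: enn2ereal_ennreal)
  also have "\<dots> = ereal (LINT \<omega>|M. b - h \<omega>)"
    using hi by (intro ereal_expectation_real) auto
  also have "(LINT \<omega>|M. b - h \<omega>) = b - (LINT \<omega>|M. h \<omega>)"
    using hi prob_space by simp
  also have "ereal \<dots> = ereal b - enn2ereal (\<integral>\<^sup>+ \<omega>. k \<omega> \<partial>M)"
    unfolding eq using hi nn
    by (subst nn_integral_eq_integral) (auto simp: enn2ereal_ennreal integral_nonneg_AE)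
  finally show ?thesis .
qed

section \<open>Stability of the payoff\<close>

lemma ereal_minus_enn2ereal_less_iff:
  "ereal a < ereal b - enn2ereal x \<longleftrightarrow> (\<exists>y\<ge>0. x = ennreal y \<and> a < b - y)"
proof (cases x)
  case (real y)
  then show ?thesis by (auto simp: enn2ereal_ennreal)
qed auto

text \<open>Continuity of \<open>F\<close> at \<open>\<nu>\<close>, expressed by finitely many events. One-sided bounds suffice because lower bounds on
  the masses of open sets characterise weak convergence to \<open>\<nu>\<close>.\<close>

lemma functional_lower_near_law:
  fixes \<nu> :: "'a::polish_space measure" and U :: "nat \<Rightarrow> 'a set"
    and F :: "'a measure \<Rightarrow> real"
  assumes \<nu>: "\<nu> \<in> borel_probs" and F: "continuous_map weak_topology euclideanreal F"
    and U: "\<And>i. open (U i)" "\<And>G. open G \<Longrightarrow> \<exists>k. incseq (\<lambda>j. U (k j)) \<and> (\<Union>j. U (k j)) = G"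
    and \<epsilon>: "0 < \<epsilon>"
  obtains m \<delta> where "0 < \<delta>"
    "\<And>q. q \<in> borel_probs \<Longrightarrow> (\<And>i::nat. i < m \<Longrightarrow> measure \<nu> (U i) - \<delta> < measure q (U i)) \<Longrightarrow> F \<nu> - \<epsilon> \<le> F q"
proof (rule ccontr)
  assume "\<not> thesis"
  have ex: "\<forall>n. \<exists>q. q \<in> borel_probs \<and> (\<forall>i<n. measure \<nu> (U i) - 1 / Suc n < measure q (U i)) \<and> F q < F \<nu> - \<epsilon>"
  proof (intro allI, rule ccontr, goal_cases)
    case neg: (1 n)
    have thesis
    proof (rule that[of "1 / Suc n" n])
      fix q assume "q \<in> borel_probs" "\<And>i. i < n \<Longrightarrow> measure \<nu> (U i) - 1 / Suc n < measure q (U i)"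
      with neg have "\<not> F q < F \<nu> - \<epsilon>" by blast
      then show "F \<nu> - \<epsilon> \<le> F q" by simp
    qed simp
    with \<open>\<not> thesis\<close> show False ..
  qed
  obtain q where q: "\<And>n. q n \<in> borel_probs"
      "\<And>n i. i < n \<Longrightarrow> measure \<nu> (U i) - 1 / Suc n < measure (q n) (U i)" "\<And>n. F (q n) < F \<nu> - \<epsilon>"
    using choice[OF ex] by auto
  interpret q: prob_space "q n" for n using q(1) by (rule borel_probsD)
  interpret \<nu>: prob_space \<nu> using \<nu> by (rule borel_probsD)
  have "emeasure \<nu> (U i) \<le> liminf (\<lambda>n. emeasure (q n) (U i))" for i
  proof -
    have "(\<lambda>n. ennreal (measure \<nu> (U i) - 1 / Suc n)) \<longlonglongrightarrow> ennreal (measure \<nu> (U i) - 0)"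
      by (intro tendsto_ennrealI tendsto_diff tendsto_const LIMSEQ_Suc[OF lim_1_over_n])
    then have "emeasure \<nu> (U i) = liminf (\<lambda>n. ennreal (measure \<nu> (U i) - 1 / Suc n))"
      by (simp add: lim_imp_Liminf \<nu>.emeasure_eq_measure)
    also have "\<dots> \<le> liminf (\<lambda>n. emeasure (q n) (U i))"
    proof (rule Liminf_mono)
      show "eventually (\<lambda>n. ennreal (measure \<nu> (U i) - 1 / Suc n) \<le> emeasure (q n) (U i)) sequentially"
        using eventually_gt_at_top[of i]
        by eventually_elim (use q(2) in \<open>auto simp: q.emeasure_eq_measure intro!: ennreal_leI less_imp_le\<close>)
    qed
    finally show ?thesis .
  qed
  note base = this
  have "emeasure \<nu> G \<le> liminf (\<lambda>n. emeasure (q n) G)" if "open G" for G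
  proof (rule emeasure_open_le_if_approximation[OF U borel_probsD(2)[OF \<nu>] _ base that])
    fix G H :: "'a set" assume "G \<subseteq> H" "open G" "open H"
    then show "liminf (\<lambda>n. emeasure (q n) G) \<le> liminf (\<lambda>n. emeasure (q n) H)"
      using borel_probsD[OF q(1)] by (intro Liminf_mono always_eventually allI emeasure_mono) auto
  qed
  then have "portmanteau_conv q \<nu>" by (simp add: portmanteau_conv_def)
  from portmanteau_conv_continuous_functional[OF this q(1) \<nu> F]
  have "F \<nu> \<le> F \<nu> - \<epsilon>"
    by (rule LIMSEQ_le_const2) (use q(3) in \<open>auto intro: less_imp_le\<close>)
  with \<epsilon> show False by simp
qed

text \<open>A sequence of measures violating the conclusion has bounded costs because \<open>F\<close> is bounded above. If
  \<open>x \<in> K j\<close> and \<open>c (x, y) \<le> 2 ^ j\<close>, then \<open>y\<close> lies in a fixed compact set \<open>L j\<close>, so the hypothesis on the first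
  marginals and Markov's inequality for the cost give tightness. The limit of a subsequence has first
  marginal \<open>\<mu>\<close> and payoff at least \<open>S + \<epsilon> / 2\<close>, although \<open>S\<close> bounds all such payoffs.\<close>

lemma payoff_upper_near_marginal:
  fixes \<mu> :: "'a::polish_space measure" and U :: "nat \<Rightarrow> 'a set"
    and F :: "'a measure \<Rightarrow> real" and c :: "'a \<times> 'a \<Rightarrow> ennreal" and K :: "nat \<Rightarrow> 'a set"
  assumes \<mu>: "\<mu> \<in> borel_probs" and F: "continuous_map weak_topology euclideanreal F"
    and c: "lower_semicontinuous c"
    and inf_compact: "\<And>(K :: 'a set) (m :: real). compact K \<Longrightarrow> 0 \<le> m \<Longrightarrow>
           compact (closure {y. (INF x\<in>K. c (x, y)) \<le> ennreal m})"
    and B: "\<And>\<nu>. \<nu> \<in> borel_probs \<Longrightarrow> F \<nu> \<le> B"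
    and S: "\<And>p. p \<in> borel_probs \<Longrightarrow> distr p borel fst = \<mu> \<Longrightarrow>
        ereal (F (distr p borel snd)) - enn2ereal (\<integral>\<^sup>+ z. c z \<partial>p) \<le> ereal S"
    and K: "\<And>j::nat. compact (K j)"
    and U: "\<And>i. open (U i)" "\<And>G. open G \<Longrightarrow> \<exists>k. incseq (\<lambda>j. U (k j)) \<and> (\<Union>j. U (k j)) = G"
    and \<epsilon>: "0 < \<epsilon>"
  obtains m \<delta> where "0 < \<delta>"
    "\<And>p. p \<in> borel_probs \<Longrightarrow> (\<And>j. measure (distr p borel fst) (- K j) \<le> R * (1/2) ^ j) \<Longrightarrow>
      (\<And>i::nat. i < m \<Longrightarrow> measure (distr p borel fst) (U i) < measure \<mu> (U i) + \<delta>) \<Longrightarrow>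
      ereal (F (distr p borel snd)) - enn2ereal (\<integral>\<^sup>+ z. c z \<partial>p) \<le> ereal (S + \<epsilon>)"
proof (rule ccontr)
  assume "\<not> thesis"
  have ex: "\<forall>n. \<exists>p. p \<in> borel_probs \<and> (\<forall>j. measure (distr p borel fst) (- K j) \<le> R * (1/2) ^ j) \<and>
      (\<forall>i<n. measure (distr p borel fst) (U i) < measure \<mu> (U i) + 1 / Suc n) \<and>
      ereal (S + \<epsilon>) < ereal (F (distr p borel snd)) - enn2ereal (\<integral>\<^sup>+ z. c z \<partial>p)"
  proof (intro allI, rule ccontr, goal_cases)
    case neg: (1 n)
    have thesis
    proof (rule that[of "1 / Suc n" n])
      fix p :: "('a \<times> 'a) measure"
      assume "p \<in> borel_probs" "\<And>j. measure (distr p borel fst) (- K j) \<le> R * (1/2) ^ j"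
        "\<And>i. i < n \<Longrightarrow> measure (distr p borel fst) (U i) < measure \<mu> (U i) + 1 / Suc n"
      with neg have "\<not> ereal (S + \<epsilon>) < ereal (F (distr p borel snd)) - enn2ereal (\<integral>\<^sup>+ z. c z \<partial>p)"
        by blast
      then show "ereal (F (distr p borel snd)) - enn2ereal (\<integral>\<^sup>+ z. c z \<partial>p) \<le> ereal (S + \<epsilon>)"
        by (simp only: not_less)
    qed simp
    with \<open>\<not> thesis\<close> show False ..
  qed
  obtain p where p: "\<And>n. p n \<in> borel_probs"
      and pK: "\<And>n j. measure (distr (p n) borel fst) (- K j) \<le> R * (1/2) ^ j"
      and pU: "\<And>n i. i < n \<Longrightarrow> measure (distr (p n) borel fst) (U i) < measure \<mu> (U i) + 1 / Suc n"
      and pS: "\<And>n. ereal (S + \<epsilon>) < ereal (F (distr (p n) borel snd)) - enn2ereal (\<integral>\<^sup>+ z. c z \<partial>p n)"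
    using choice[OF ex] by auto
  have fst_m: "fst \<in> borel_measurable (borel :: ('a \<times> 'a) measure)"
    and snd_m: "snd \<in> borel_measurable (borel :: ('a \<times> 'a) measure)"
    by (simp_all add: borel_prod[symmetric])
  have p1: "distr (p n) borel fst \<in> borel_probs" and p2: "distr (p n) borel snd \<in> borel_probs" for n
    using p fst_m snd_m by (auto intro: distr_borel_probs)
  have "\<forall>n. \<exists>y\<ge>0. (\<integral>\<^sup>+ z. c z \<partial>p n) = ennreal y \<and> S + \<epsilon> < F (distr (p n) borel snd) - y"
    using pS unfolding ereal_minus_enn2ereal_less_iff by blast
  from choice[OF this] obtain x where x: "\<And>n. 0 \<le> x n" "\<And>n. (\<integral>\<^sup>+ z. c z \<partial>p n) = ennreal (x n)"
      "\<And>n. S + \<epsilon> < F (distr (p n) borel snd) - x n"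
    by auto
  define T where "T = B - S - \<epsilon>"
  have xT: "x n \<le> T" for n using x(3)[of n] B[OF p2[of n]] by (simp add: T_def)
  interpret p: prob_space "p n" for n using p by (rule borel_probsD)
  have [simp]: "sets (p n) = sets borel" "space (p n) = UNIV" for n using borel_probsD[OF p] by auto
  have c_m: "c \<in> borel_measurable (p n)" for n
    using lower_semicontinuous_measurable[OF c] by (simp cong: measurable_cong_sets)
  define L where "L j = closure {y. (INF x\<in>K j. c (x, y)) \<le> ennreal (2 ^ j)}" for j
  have L: "compact (L j)" for j unfolding L_def by (intro inf_compact K) auto
  have tight: "measure (p n) (- (K j \<times> L j)) \<le> (R + T) * (1/2) ^ j" for n j
  proof -
    \<comment> \<open>the event \<open>2 ^ j \<le> c z\<close>, in the form of Markov's inequality\<close>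
    define E where "E = {z \<in> UNIV. 1 \<le> ennreal ((1/2) ^ j) * c z}"
    have E_m: "E \<in> sets (p n)" unfolding E_def
    proof -
      have "{z \<in> space (p n). 1 \<le> ennreal ((1/2) ^ j) * c z} \<in> sets (p n)" using c_m[of n] by measurable
      then show "{z \<in> UNIV. 1 \<le> ennreal ((1/2) ^ j) * c z} \<in> sets (p n)" by simp
    qed
    have "emeasure (p n) E \<le> ennreal ((1/2) ^ j) * (\<integral>\<^sup>+ z. c z * indicator UNIV z \<partial>p n)"
      unfolding E_def using c_m by (intro nn_integral_Markov_inequality) auto
    also have "\<dots> = ennreal ((1/2) ^ j * x n)" using x(1)[of n] by (simp add: x(2) ennreal_mult)
    finally have "measure (p n) E \<le> (1/2) ^ j * x n" using x(1)[of n] by (simp add: p.emeasure_eq_measure)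
    also have "\<dots> \<le> (1/2) ^ j * T" by (intro mult_left_mono xT) auto
    finally have mE: "measure (p n) E \<le> T * (1/2) ^ j" by (simp add: mult.commute)
    have Kc: "- K j \<in> sets borel"
      by (intro borel_comp borel_closed compact_imp_closed K)
    have fst_p: "fst \<in> measurable (p n) borel"
      using fst_m by (simp cong: measurable_cong_sets)
    have K_m: "fst -` (- K j) \<in> sets (p n)"
      using measurable_sets[OF fst_p Kc] by simp
    have mK: "measure (p n) (fst -` (- K j)) \<le> R * (1/2) ^ j"
      using pK[of n j] by (simp add: measure_distr[OF fst_p Kc])
    have "- (K j \<times> L j) \<subseteq> fst -` (- K j) \<union> E"
    proof
      fix z assume z: "z \<in> - (K j \<times> L j)"
      show "z \<in> fst -` (- K j) \<union> E"
      proof (cases "fst z \<in> K j")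
        case True
        with z have "snd z \<notin> L j" by (simp add: mem_Times_iff)
        then have "snd z \<notin> {y. (INF x\<in>K j. c (x, y)) \<le> ennreal (2 ^ j)}"
          unfolding L_def using closure_subset by (rule contra_subsetD[rotated])
        then have "ennreal (2 ^ j) < (INF x\<in>K j. c (x, snd z))"
          by (simp only: mem_Collect_eq not_le)
        also have "\<dots> \<le> c (fst z, snd z)" using True by (rule INF_lower)
        finally have "ennreal (2 ^ j) \<le> c z" by (simp only: prod.collapse less_imp_le)
        then have "ennreal ((1/2) ^ j) * ennreal (2 ^ j) \<le> ennreal ((1/2) ^ j) * c z"
          by (intro mult_left_mono) auto
        also have "ennreal ((1/2) ^ j) * ennreal (2 ^ j) = 1"
          by (subst ennreal_mult[symmetric]) (simp_all add: power_one_over)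
        finally have "z \<in> E" unfolding E_def by (simp only: mem_Collect_eq UNIV_I simp_thms)
        then show ?thesis by (rule UnI2)
      qed simp
    qed
    then have "measure (p n) (- (K j \<times> L j)) \<le> measure (p n) (fst -` (- K j) \<union> E)"
      using K_m E_m by (intro p.finite_measure_mono) auto
    also have "\<dots> \<le> measure (p n) (fst -` (- K j)) + measure (p n) E"
      using K_m E_m by (intro measure_Un_le) auto
    finally show ?thesis using mE mK by (simp add: distrib_right)
  qed
  have "(\<lambda>j. (R + T) * (1/2::real) ^ j) \<longlonglongrightarrow> (R + T) * 0"
    by (intro tendsto_mult tendsto_const LIMSEQ_realpow_zero) auto
  then have e0: "(\<lambda>j. (R + T) * (1/2::real) ^ j) \<longlonglongrightarrow> 0" by simp
  obtain \<phi> q where \<phi>: "strict_mono \<phi>" and q: "q \<in> borel_probs" and conv: "portmanteau_conv (p \<circ> \<phi>) q"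
    by (rule prokhorov[of p "\<lambda>j. K j \<times> L j", OF p compact_Times[OF K L] tight e0])
  have p\<phi>: "(p \<circ> \<phi>) n \<in> borel_probs" for n using p by simp
  have c1: "portmanteau_conv (\<lambda>n. distr (p (\<phi> n)) borel fst) (distr q borel fst)"
    and c2: "portmanteau_conv (\<lambda>n. distr (p (\<phi> n)) borel snd) (distr q borel snd)"
    using portmanteau_conv_distr[OF conv p\<phi> q continuous_on_fst[OF continuous_on_id]]
      portmanteau_conv_distr[OF conv p\<phi> q continuous_on_snd[OF continuous_on_id]] by simp_all
  have q1: "distr q borel fst \<in> borel_probs" and q2: "distr q borel snd \<in> borel_probs"
    using q fst_m snd_m by (auto intro: distr_borel_probs)
  interpret \<mu>: prob_space \<mu> using \<mu> by (rule borel_probsD)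
  interpret p1: prob_space "distr (p n) borel fst" for n using p1 by (rule borel_probsD)
  have "emeasure (distr q borel fst) (U i) \<le> emeasure \<mu> (U i)" for i
  proof -
    have "(\<lambda>n. ennreal (measure \<mu> (U i) + 1 / Suc n)) \<longlonglongrightarrow> ennreal (measure \<mu> (U i) + 0)"
      by (intro tendsto_ennrealI tendsto_add tendsto_const LIMSEQ_Suc[OF lim_1_over_n])
    from LIMSEQ_subseq_LIMSEQ[OF this \<phi>]
    have lim: "(\<lambda>n. ennreal (measure \<mu> (U i) + 1 / Suc (\<phi> n))) \<longlonglongrightarrow> emeasure \<mu> (U i)"
      by (simp add: o_def \<mu>.emeasure_eq_measure)
    have "emeasure (distr q borel fst) (U i) \<le> liminf (\<lambda>n. emeasure (distr (p (\<phi> n)) borel fst) (U i))"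
      using c1 U(1) by (simp add: portmanteau_conv_def)
    also have "\<dots> \<le> liminf (\<lambda>n. ennreal (measure \<mu> (U i) + 1 / Suc (\<phi> n)))"
    proof (rule Liminf_mono)
      show "eventually (\<lambda>n. emeasure (distr (p (\<phi> n)) borel fst) (U i) \<le> ennreal (measure \<mu> (U i) + 1 / Suc (\<phi> n))) sequentially"
        using eventually_gt_at_top[of i]
      proof eventually_elim
        case (elim n)
        then have "i < \<phi> n" using seq_suble[OF \<phi>, of n] by simp
        from pU[OF this] show ?case
          unfolding p1.emeasure_eq_measure by (intro ennreal_leI less_imp_le)
      qed
    qed
    also have "\<dots> = emeasure \<mu> (U i)" using lim by (intro lim_imp_Liminf) auto
    finally show ?thesis .
  qed
  note base = this
  have "emeasure (distr q borel fst) G \<le> emeasure \<mu> G" if "open G" for G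
    by (rule emeasure_open_le_if_approximation[OF U _ emeasure_mono base that])
      (use borel_probsD[OF \<mu>] in auto)
  then have "distr q borel fst = \<mu>" by (rule borel_probs_eqI_open[OF q1 \<mu>])
  from S[OF q this] have qS: "ereal (F (distr q borel snd)) - enn2ereal (\<integral>\<^sup>+ z. c z \<partial>q) \<le> ereal S" .
  define y where "y = F (distr q borel snd) - S - \<epsilon> / 2"
  have "(\<lambda>n. F (distr (p (\<phi> n)) borel snd)) \<longlonglongrightarrow> F (distr q borel snd)"
    using p2 by (intro portmanteau_conv_continuous_functional[OF c2 _ q2 F])
  from order_tendstoD(2)[OF this, of "F (distr q borel snd) + \<epsilon> / 2"]
  have "eventually (\<lambda>n. F (distr (p (\<phi> n)) borel snd) < F (distr q borel snd) + \<epsilon> / 2) sequentially"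
    using \<epsilon> by simp
  then have ev: "eventually (\<lambda>n. x (\<phi> n) < y) sequentially"
  proof eventually_elim
    case (elim n)
    then show ?case using x(3)[of "\<phi> n"] by (simp add: y_def)
  qed
  then obtain n where "x (\<phi> n) < y" by (auto simp: eventually_sequentially)
  then have y0: "0 \<le> y" using x(1)[of "\<phi> n"] by simp
  have "(\<integral>\<^sup>+ z. c z \<partial>q) \<le> liminf (\<lambda>n. \<integral>\<^sup>+ z. c z \<partial>(p \<circ> \<phi>) n)"
    by (rule portmanteau_conv_nn_integral[OF conv p\<phi> q c])
  also have "\<dots> \<le> liminf (\<lambda>n. ennreal y)"
    by (rule Liminf_mono) (use ev in \<open>auto simp: x(2) elim!: eventually_mono intro!: ennreal_leI\<close>)
  also have "\<dots> = ennreal y" by (simp add: Liminf_const)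
  finally have le: "(\<integral>\<^sup>+ z. c z \<partial>q) \<le> ennreal y" .
  then obtain w where w: "(\<integral>\<^sup>+ z. c z \<partial>q) = ennreal w" "0 \<le> w"
    by (cases "\<integral>\<^sup>+ z. c z \<partial>q") (auto simp: top_unique)
  then have "w \<le> y" using le y0 by simp
  moreover have "F (distr q borel snd) - w \<le> S" using qS w by (simp add: enn2ereal_ennreal)
  ultimately show False using \<epsilon> by (simp add: y_def)
qed

section \<open>The upper bound for arbitrary controls\<close>

text \<open>Markov's inequality for each \<open>j\<close> gives a geometric series. The bound does not depend on \<open>n\<close>, so all of the
  infinitely many tail conditions hold at once with high probability.\<close>

lemma empirical_tail_event:
  fixes X :: "nat \<Rightarrow> 'b \<Rightarrow> 'a::topological_space"
  assumes M: "prob_space M" and X: "\<And>i. i \<in> {1..n} \<Longrightarrow> X i \<in> borel_measurable M"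
    and law: "\<And>i. i \<in> {1..n} \<Longrightarrow> distr M borel (X i) = \<mu>"
    and n: "1 \<le> n" and A: "\<And>j. A j \<in> sets borel" "\<And>j. measure \<mu> (A j) \<le> (1/4) ^ j" and R: "0 < R"
  shows "{\<omega> \<in> space M. \<exists>j::nat. R * (1/2) ^ j \<le> measure (empirical n (\<lambda>i. X i \<omega>)) (A j)} \<in> sets M"
    and "measure M {\<omega> \<in> space M. \<exists>j. R * (1/2) ^ j \<le> measure (empirical n (\<lambda>i. X i \<omega>)) (A j)} \<le> 2 / R"
proof -
  interpret prob_space M by fact
  define u where "u j \<omega> = measure (empirical n (\<lambda>i. X i \<omega>)) (A j)" for j \<omega>
  have int: "integrable M (\<lambda>\<omega>. indicator (A j) (X i \<omega>) :: real)" if "i \<in> {1..n}" for i j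
    using measurable_compose[OF X[OF that] borel_measurable_indicator[OF A(1)]]
    by (intro integrable_const_bound[where B=1]) auto
  have u_eq: "u j = (\<lambda>\<omega>. (\<Sum>i = 1..n. indicator (A j) (X i \<omega>)) / real n)" for j
    unfolding u_def using measure_empirical[OF n A(1)] by auto
  have u_int: "integrable M (u j)" for j
    unfolding u_eq using int by (intro integrable_divide_zero integrable_sum) auto
  have "(LINT \<omega>|M. u j \<omega>) = (\<Sum>i = 1..n. (LINT \<omega>|M. indicator (A j) (X i \<omega>))) / real n" for j
    unfolding u_eq using int by (simp add: Bochner_Integration.integral_sum del: One_nat_def)
  moreover have "(LINT \<omega>|M. indicator (A j) (X i \<omega>)) = measure \<mu> (A j)" if "i \<in> {1..n}" for i j
  proof -
    have "(LINT \<omega>|M. indicator (A j) (X i \<omega>)) = (LINT x|distr M borel (X i). indicator (A j) x :: real)"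
      using X[OF that] A(1) by (intro integral_distr[symmetric]) auto
    also have "\<dots> = measure (distr M borel (X i)) (A j)" using A(1)[of j] by simp
    finally show ?thesis by (simp only: law[OF that])
  qed
  ultimately have u_exp: "(LINT \<omega>|M. u j \<omega>) = measure \<mu> (A j)" for j
    using n by (simp del: One_nat_def)
  define B where "B j = {\<omega> \<in> space M. R * (1/2) ^ j \<le> u j \<omega>}" for j
  have B: "B j \<in> sets M" for j
    unfolding B_def using borel_measurable_integrable[OF u_int[of j]] by measurable
  have mB: "measure M (B j) \<le> (1/2) ^ j / R" for j
  proof -
    have "measure M (B j) \<le> (LINT \<omega>|M. u j \<omega>) / (R * (1/2) ^ j)"
      unfolding B_def using R
      by (intro integral_Markov_inequality_measure[where A="{}"] u_int) (auto simp: u_def)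
    also have "\<dots> \<le> (1/4) ^ j / (R * (1/2) ^ j)"
      unfolding u_exp using A(2) R by (intro divide_right_mono) auto
    also have "\<dots> = (1/2) ^ j / R"
    proof -
      have "(1/4::real) ^ j = (1/2) ^ j * (1/2) ^ j"
        by (simp only: power_mult_distrib[symmetric]) simp
      then show ?thesis by simp
    qed
    finally show ?thesis .
  qed
  have geo: "(\<lambda>j. (1/2::real) ^ j / R) sums (2 / R)"
    using sums_divide[OF geometric_sums[of "1/2::real"], of R] by simp
  have sB: "summable (\<lambda>j. measure M (B j))"
    by (rule summable_comparison_test[OF _ sums_summable[OF geo]])
      (use mB in \<open>auto intro!: exI[of _ 0]\<close>)
  have eq: "{\<omega> \<in> space M. \<exists>j. R * (1/2) ^ j \<le> measure (empirical n (\<lambda>i. X i \<omega>)) (A j)} = (\<Union>j. B j)"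
    by (auto simp: B_def u_def)
  show "{\<omega> \<in> space M. \<exists>j::nat. R * (1/2) ^ j \<le> measure (empirical n (\<lambda>i. X i \<omega>)) (A j)} \<in> sets M"
    unfolding eq using B by auto
  have "measure M (\<Union>j. B j) \<le> (\<Sum>j. measure M (B j))"
    using B sB by (intro finite_measure_subadditive_countably) auto
  also have "\<dots> \<le> (\<Sum>j. (1/2) ^ j / R)"
    using mB sB sums_summable[OF geo] by (rule suminf_le)
  also have "\<dots> = 2 / R" using geo by (simp add: sums_iff)
  finally show "measure M {\<omega> \<in> space M. \<exists>j. R * (1/2) ^ j \<le> measure (empirical n (\<lambda>i. X i \<omega>)) (A j)} \<le> 2 / R"
    unfolding eq .
qed

text \<open>The empirical measure of the pairs \<open>(X\<^sub>i, Y\<^sub>i)\<close> satisfies the deterministic bound outside of an event that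
  depends on the \<open>X\<^sub>i\<close> only and has small probability, uniformly in \<open>Y\<close>. On this event the payoff is at most
  \<open>B\<close>.\<close>

lemma control_payoff_upper_bound:
  fixes \<mu> :: "'a::polish_space measure" and F :: "'a measure \<Rightarrow> real" and c :: "'a \<times> 'a \<Rightarrow> ennreal"
    and X :: "nat \<Rightarrow> 'b \<Rightarrow> 'a"
  assumes \<mu>: "\<mu> \<in> borel_probs" and F: "continuous_map weak_topology euclideanreal F"
    and c: "lower_semicontinuous c"
    and inf_compact: "\<And>(K :: 'a set) (m :: real). compact K \<Longrightarrow> 0 \<le> m \<Longrightarrow>
           compact (closure {y. (INF x\<in>K. c (x, y)) \<le> ennreal m})"
    and M: "prob_space M" and indep: "prob_space.indep_vars M (\<lambda>_. borel) X {1..}"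
    and law: "\<And>i. 1 \<le> i \<Longrightarrow> distr M borel (X i) = \<mu>"
    and B: "\<And>\<nu>. \<nu> \<in> borel_probs \<Longrightarrow> F \<nu> \<le> B"
    and S: "\<And>p. p \<in> borel_probs \<Longrightarrow> distr p borel fst = \<mu> \<Longrightarrow>
        ereal (F (distr p borel snd)) - enn2ereal (\<integral>\<^sup>+ z. c z \<partial>p) \<le> ereal S"
    and \<epsilon>: "0 < \<epsilon>"
  shows "eventually (\<lambda>n. \<forall>Y. ereal_expectation M (\<lambda>\<omega>.
              ereal (F (empirical n (\<lambda>i. Y i \<omega>)))
              - enn2ereal (ennreal (1 / real n) * (\<Sum>i = 1..n. c (X i \<omega>, Y i \<omega>)))) \<le> ereal (S + 2 * \<epsilon>)) sequentially"
proof -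
  interpret prob_space M by fact
  have X: "X i \<in> borel_measurable M" if "1 \<le> i" for i
    using indep that unfolding indep_vars_def by auto
  obtain K :: "nat \<Rightarrow> 'a set" where K: "\<And>j. compact (K j)" "\<And>j. measure \<mu> (- K j) \<le> (1/4) ^ j"
    using compact_exhaustion[OF \<mu>] by blast
  obtain U :: "nat \<Rightarrow> 'a set" where U: "\<And>i. open (U i)"
      "\<And>G. open G \<Longrightarrow> \<exists>k. incseq (\<lambda>j. U (k j)) \<and> (\<Union>j. U (k j)) = G"
    using countable_open_approximation by blast
  define D where "D = max 0 (B - S)"
  \<comment> \<open>the tail event costs at most \<open>D * (2 / R)\<close>, which this choice makes at most \<open>\<epsilon> / 2\<close>\<close>
  define R where "R = 4 * (D + 1) / \<epsilon>"
  have D: "0 \<le> D" "B \<le> S + D" by (auto simp: D_def)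
  have R: "0 < R" using D \<epsilon> by (simp add: R_def)
  have DR: "D * (2 / R) \<le> \<epsilon> / 2" using D \<epsilon> by (simp add: R_def field_simps)
  obtain m \<delta> where \<delta>: "0 < \<delta>" and key: "\<And>p. p \<in> borel_probs \<Longrightarrow>
      (\<And>j. measure (distr p borel fst) (- K j) \<le> R * (1/2) ^ j) \<Longrightarrow>
      (\<And>i::nat. i < m \<Longrightarrow> measure (distr p borel fst) (U i) < measure \<mu> (U i) + \<delta>) \<Longrightarrow>
      ereal (F (distr p borel snd)) - enn2ereal (\<integral>\<^sup>+ z. c z \<partial>p) \<le> ereal (S + \<epsilon>)"
    by (rule payoff_upper_near_marginal[where K=K and U=U and R=R, OF \<mu> F c inf_compact B S _ _ _ \<epsilon>])
      (assumption | rule K(1) U(1) | rule U(2), assumption | blast)+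
  have "(\<lambda>n. D * (real m * (2 * exp (- 2 * real n * \<delta>\<^sup>2)))) \<longlonglongrightarrow> D * 0"
    by (intro tendsto_mult tendsto_const deviation_bound_tendsto_0 \<delta>)
  from order_tendstoD(2)[OF this, of "\<epsilon> / 2"]
  have "eventually (\<lambda>n. D * (real m * (2 * exp (- 2 * real n * \<delta>\<^sup>2))) < \<epsilon> / 2) sequentially"
    using \<epsilon> by simp
  then show ?thesis
    using eventually_ge_at_top[of 1]
  proof eventually_elim
    case (elim n)
    then have n: "1 \<le> n" by simp
    have indep_n: "indep_vars (\<lambda>_. borel) X {1..n}"
      using indep by (rule indep_vars_subset) auto
    have law_n: "distr M borel (X i) = \<mu>" if "i \<in> {1..n}" for i
      using that law by auto
    have X_n: "X i \<in> borel_measurable M" if "i \<in> {1..n}" for i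
      using that X by auto
    have Ub: "U i \<in> sets borel" for i using U(1) by simp
    have Kb: "- K j \<in> sets borel" for j
      by (intro borel_comp borel_closed compact_imp_closed K)
    let ?L = "\<lambda>\<omega>. empirical n (\<lambda>i. X i \<omega>)"
    define B1 where "B1 = {\<omega> \<in> space M. \<exists>i<m. \<delta> \<le> \<bar>measure (?L \<omega>) (U i) - measure \<mu> (U i)\<bar>}"
    define B2 where "B2 = {\<omega> \<in> space M. \<exists>j. R * (1/2) ^ j \<le> measure (?L \<omega>) (- K j)}"
    have B1: "B1 \<in> sets M" "measure M B1 \<le> real m * (2 * exp (- 2 * real n * \<delta>\<^sup>2))"
      unfolding B1_def
      by (rule empirical_deviation_finite[where U=U]; fact M indep_n law_n n Ub \<delta>)+
    have B2: "B2 \<in> sets M" "measure M B2 \<le> 2 / R"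
      unfolding B2_def
      by (rule empirical_tail_event[where A="\<lambda>j. - K j"]; fact M X_n law_n n Kb K(2) R)+
    show ?case
    proof
      fix Y :: "nat \<Rightarrow> 'b \<Rightarrow> 'a"
      let ?G = "\<lambda>\<omega>. ereal (F (empirical n (\<lambda>i. Y i \<omega>)))
              - enn2ereal (ennreal (1 / real n) * (\<Sum>i = 1..n. c (X i \<omega>, Y i \<omega>)))"
      let ?h = "\<lambda>\<omega>. S + \<epsilon> + D * indicator (B1 \<union> B2) \<omega>"
      have G: "?G \<omega> \<le> ereal (?h \<omega>)" if "\<omega> \<in> space M" for \<omega>
      proof (cases "\<omega> \<in> B1 \<union> B2")
        case True
        have "?G \<omega> \<le> ereal (F (empirical n (\<lambda>i. Y i \<omega>)))"
          by (cases "ennreal (1 / real n) * (\<Sum>i = 1..n. c (X i \<omega>, Y i \<omega>))") (auto simp: enn2ereal_ennreal)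
        also have "\<dots> \<le> ereal (?h \<omega>)"
          using True B[OF empirical_in_borel_probs[OF n], of "\<lambda>i. Y i \<omega>"] D \<epsilon> by simp
        finally show ?thesis .
      next
        case False
        define p where "p = empirical n (\<lambda>i. (X i \<omega>, Y i \<omega>))"
        have p1: "distr p borel fst = ?L \<omega>" and p2: "distr p borel snd = empirical n (\<lambda>i. Y i \<omega>)"
          unfolding p_def by (subst distr_empirical[OF n]; simp add: borel_prod[symmetric])+
        have pc: "(\<integral>\<^sup>+ z. c z \<partial>p) = ennreal (1 / real n) * (\<Sum>i = 1..n. c (X i \<omega>, Y i \<omega>))"
          unfolding p_def by (rule nn_integral_empirical[OF n lower_semicontinuous_measurable[OF c]])
        have "ereal (F (distr p borel snd)) - enn2ereal (\<integral>\<^sup>+ z. c z \<partial>p) \<le> ereal (S + \<epsilon>)"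
        proof (rule key)
          show "p \<in> borel_probs" unfolding p_def using n by (rule empirical_in_borel_probs)
          show "measure (distr p borel fst) (- K j) \<le> R * (1/2) ^ j" for j
          proof -
            have "\<not> R * (1/2) ^ j \<le> measure (?L \<omega>) (- K j)"
              using False that unfolding B2_def by blast
            then show ?thesis unfolding p1 by (simp only: not_le less_imp_le)
          qed
          show "measure (distr p borel fst) (U i) < measure \<mu> (U i) + \<delta>" if "i < m" for i
          proof -
            have "\<not> \<delta> \<le> \<bar>measure (?L \<omega>) (U i) - measure \<mu> (U i)\<bar>"
              using False that \<open>\<omega> \<in> space M\<close> unfolding B1_def by blast
            then show ?thesis unfolding p1 by linarith
          qed
        qed
        then show ?thesis using False by (simp add: pc p2)
      qed
      have B12: "B1 \<union> B2 \<in> sets M" using B1 B2 by blast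
      have int_i: "integrable M (indicator (B1 \<union> B2) :: _ \<Rightarrow> real)"
        using B12 by (intro integrable_const_bound[where B=1]) auto
      have "ereal_expectation M ?G \<le> ereal_expectation M (\<lambda>\<omega>. ereal (?h \<omega>))"
        by (rule ereal_expectation_mono) (use G in auto)
      also have "\<dots> = ereal (LINT \<omega>|M. ?h \<omega>)"
        using int_i by (intro ereal_expectation_real) auto
      also have "(LINT \<omega>|M. ?h \<omega>) = S + \<epsilon> + D * measure M (B1 \<union> B2)"
        using int_i prob_space sets.sets_into_space[OF B12] by (simp add: Int_absorb2)
      also have "ereal \<dots> \<le> ereal (S + 2 * \<epsilon>)"
      proof -
        have "measure M (B1 \<union> B2) \<le> measure M B1 + measure M B2"
          using B1 B2 by (intro measure_Un_le) auto
        also have "\<dots> \<le> real m * (2 * exp (- 2 * real n * \<delta>\<^sup>2)) + 2 / R"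
          by (intro add_mono B1 B2)
        finally have "D * measure M (B1 \<union> B2) \<le> D * (real m * (2 * exp (- 2 * real n * \<delta>\<^sup>2)) + 2 / R)"
          using D by (intro mult_left_mono) auto
        also have "\<dots> \<le> \<epsilon> / 2 + \<epsilon> / 2"
          unfolding distrib_left using elim(1) DR by (intro add_mono) auto
        finally show ?thesis by simp
      qed
      finally show "ereal_expectation M ?G \<le> ereal (S + 2 * \<epsilon>)" .
    qed
  qed
qed

section \<open>The lower bound by derandomised controls\<close>

text \<open>Attaching independent coordinates of law \<open>T\<close> to the sample gives an independent sample of
  law \<open>\<mu> \<Otimes>\<^sub>M T\<close>. The joint law is identified on rectangles, integrating first over the new coordinates and
  then over the \<open>X i\<close>.\<close>

lemma indep_pairs_with_product:
  fixes X :: "nat \<Rightarrow> 'b \<Rightarrow> 'a" and T :: "'c measure"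
  assumes M: "prob_space M" and T: "prob_space T" and I: "finite I" "I \<noteq> {}"
    and indep: "prob_space.indep_vars M (\<lambda>_. N) X I"
    and law: "\<And>i. i \<in> I \<Longrightarrow> distr M N (X i) = \<mu>"
  defines "W \<equiv> M \<Otimes>\<^sub>M (\<Pi>\<^sub>M i\<in>I. T)"
  shows "prob_space.indep_vars W (\<lambda>_. \<mu> \<Otimes>\<^sub>M T) (\<lambda>i z. (X i (fst z), snd z i)) I"
    and "\<And>i. i \<in> I \<Longrightarrow> distr W (\<mu> \<Otimes>\<^sub>M T) (\<lambda>z. (X i (fst z), snd z i)) = \<mu> \<Otimes>\<^sub>M T"
proof -
  interpret M: prob_space M by fact
  interpret T: prob_space T by fact
  interpret TT: product_prob_space "\<lambda>_. T" I ..
  have TI_prob: "prob_space (\<Pi>\<^sub>M i\<in>I. T)" by (intro prob_space_PiM T)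
  interpret TI: prob_space "\<Pi>\<^sub>M i\<in>I. T" by (rule TI_prob)
  interpret W: pair_prob_space M "\<Pi>\<^sub>M i\<in>I. T" ..
  obtain i0 where i0: "i0 \<in> I" using I by auto
  have X[measurable]: "X i \<in> measurable M N" if "i \<in> I" for i
    using indep that unfolding M.indep_vars_def by auto
  have s\<mu>[measurable_cong, simp]: "sets \<mu> = sets N" using law[OF i0] by auto
  interpret \<mu>: prob_space \<mu> using M.prob_space_distr[OF X[OF i0]] law[OF i0] by simp
  interpret \<mu>T: pair_prob_space \<mu> T ..
  interpret PP: product_prob_space "\<lambda>_. \<mu> \<Otimes>\<^sub>M T" I ..
  define Z where "Z i z = (X i (fst z), snd z i)" for i and z :: "'b \<times> (nat \<Rightarrow> 'c)"
  have Z: "Z i \<in> measurable W (\<mu> \<Otimes>\<^sub>M T)" if "i \<in> I" for i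
    unfolding Z_def[abs_def] W_def using X[OF that] that by measurable
  have Zv: "(\<lambda>z. \<lambda>i\<in>I. Z i z) \<in> measurable W (\<Pi>\<^sub>M i\<in>I. \<mu> \<Otimes>\<^sub>M T)"
    using Z by (rule measurable_restrict)
  have joint: "distr W (\<Pi>\<^sub>M i\<in>I. \<mu> \<Otimes>\<^sub>M T) (\<lambda>z. \<lambda>i\<in>I. Z i z) = (\<Pi>\<^sub>M i\<in>I. \<mu> \<Otimes>\<^sub>M T)"
  proof (rule PP.PiM_eqI)
    fix A assume A: "\<And>i. i \<in> I \<Longrightarrow> A i \<in> sets (\<mu> \<Otimes>\<^sub>M T)"
    have A': "A i \<in> sets (N \<Otimes>\<^sub>M T)" if "i \<in> I" for i
    proof -
      have "sets (\<mu> \<Otimes>\<^sub>M T) = sets (N \<Otimes>\<^sub>M T)" by (rule sets_pair_measure_cong) auto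
      then show ?thesis using A[OF that] by simp
    qed
    define g where "g i x = (\<integral>\<^sup>+ t. indicator (A i) (x, t) \<partial>T)" for i x
    have g: "g i \<in> borel_measurable N" if "i \<in> I" for i
      unfolding g_def[abs_def]
      by (rule T.borel_measurable_nn_integral) (use A'[OF that] in auto)
    have g_int: "(\<integral>\<^sup>+ x. g i x \<partial>\<mu>) = emeasure (\<mu> \<Otimes>\<^sub>M T) (A i)" if "i \<in> I" for i
      unfolding g_def using A[OF that] by (simp add: T.emeasure_pair_measure)
    have PE: "Pi\<^sub>E I A \<in> sets (\<Pi>\<^sub>M i\<in>I. \<mu> \<Otimes>\<^sub>M T)"
      using I(1) A by (rule sets_PiM_I_finite)
    have "emeasure (distr W (\<Pi>\<^sub>M i\<in>I. \<mu> \<Otimes>\<^sub>M T) (\<lambda>z. \<lambda>i\<in>I. Z i z)) (Pi\<^sub>E I A)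
        = (\<integral>\<^sup>+ y. indicator (Pi\<^sub>E I A) y \<partial>distr W (\<Pi>\<^sub>M i\<in>I. \<mu> \<Otimes>\<^sub>M T) (\<lambda>z. \<lambda>i\<in>I. Z i z))"
      by (rule nn_integral_indicator[symmetric]) (simp only: sets_distr PE)
    also have "\<dots> = (\<integral>\<^sup>+ z. indicator (Pi\<^sub>E I A) (\<lambda>i\<in>I. Z i z) \<partial>W)"
      by (rule nn_integral_distr[OF Zv]) (simp only: borel_measurable_indicator sets_distr PE)
    also have "\<dots> = (\<integral>\<^sup>+ z. (\<Prod>i\<in>I. indicator (A i) (X i (fst z), snd z i)) \<partial>W)"
    proof (intro nn_integral_cong)
      fix z
      show "indicator (Pi\<^sub>E I A) (\<lambda>i\<in>I. Z i z) = (\<Prod>i\<in>I. indicator (A i) (X i (fst z), snd z i) :: ennreal)"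
      proof (cases "\<forall>i\<in>I. Z i z \<in> A i")
        case True
        then show ?thesis by (simp add: Z_def PiE_iff)
      next
        case False
        then obtain i where "i \<in> I" "Z i z \<notin> A i" by auto
        then have "(\<Prod>i\<in>I. indicator (A i) (X i (fst z), snd z i) :: ennreal) = 0"
          by (intro prod_zero[OF I(1)] bexI[of _ i]) (simp_all add: Z_def)
        moreover have "(\<lambda>i\<in>I. Z i z) \<notin> Pi\<^sub>E I A" using False by (auto simp: PiE_iff)
        ultimately show ?thesis by simp
      qed
    qed
    also have "\<dots> = (\<integral>\<^sup>+ \<omega>. (\<integral>\<^sup>+ u. (\<Prod>i\<in>I. indicator (A i) (X i \<omega>, u i)) \<partial>(\<Pi>\<^sub>M i\<in>I. T)) \<partial>M)"
    proof -
      have "(\<lambda>z. indicator (A i) (X i (fst z), snd z i) :: ennreal) \<in> borel_measurable W" if "i \<in> I" for i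
        using measurable_compose[OF Z[OF that] borel_measurable_indicator[OF A[OF that]]]
        by (simp add: Z_def)
      then have "(\<lambda>z. \<Prod>i\<in>I. indicator (A i) (X i (fst z), snd z i) :: ennreal) \<in> borel_measurable W"
        by (rule borel_measurable_prod_ennreal)
      from sigma_finite_measure.nn_integral_fst[OF prob_space_imp_sigma_finite[OF TI_prob]
          this[unfolded W_def]] show ?thesis
        unfolding W_def by simp
    qed
    also have "\<dots> = (\<integral>\<^sup>+ \<omega>. (\<Prod>i\<in>I. g i (X i \<omega>)) \<partial>M)"
    proof (intro nn_integral_cong)
      fix \<omega> assume \<omega>: "\<omega> \<in> space M"
      have m: "(\<lambda>t. indicator (A i) (X i \<omega>, t) :: ennreal) \<in> borel_measurable T" if "i \<in> I" for i
      proof -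
        have "X i \<omega> \<in> space N" using X[OF that] \<omega> by (rule measurable_space)
        then have "Pair (X i \<omega>) \<in> measurable T (N \<Otimes>\<^sub>M T)" by (rule measurable_Pair1')
        from measurable_compose[OF this borel_measurable_indicator[OF A'[OF that]]]
        show ?thesis .
      qed
      show "(\<integral>\<^sup>+ u. (\<Prod>i\<in>I. indicator (A i) (X i \<omega>, u i)) \<partial>(\<Pi>\<^sub>M i\<in>I. T)) = (\<Prod>i\<in>I. g i (X i \<omega>))"
        unfolding g_def using I(1) m by (rule TT.product_nn_integral_prod)
    qed
    also have "\<dots> = (\<Prod>i\<in>I. \<integral>\<^sup>+ \<omega>. g i (X i \<omega>) \<partial>M)"
    proof (rule M.indep_vars_nn_integral[OF I(1)])
      show "M.indep_vars (\<lambda>_. borel) (\<lambda>i \<omega>. g i (X i \<omega>)) I"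
        using indep g by (rule M.indep_vars_compose2)
    qed simp
    also have "\<dots> = (\<Prod>i\<in>I. emeasure (\<mu> \<Otimes>\<^sub>M T) (A i))"
    proof (rule prod.cong[OF refl])
      fix i assume i: "i \<in> I"
      have "(\<integral>\<^sup>+ \<omega>. g i (X i \<omega>) \<partial>M) = (\<integral>\<^sup>+ x. g i x \<partial>distr M N (X i))"
        using X[OF i] g[OF i] by (subst nn_integral_distr) auto
      then show "(\<integral>\<^sup>+ \<omega>. g i (X i \<omega>) \<partial>M) = emeasure (\<mu> \<Otimes>\<^sub>M T) (A i)"
        by (simp only: law[OF i] g_int[OF i])
    qed
    finally show "emeasure (distr W (\<Pi>\<^sub>M i\<in>I. \<mu> \<Otimes>\<^sub>M T) (\<lambda>z. \<lambda>i\<in>I. Z i z)) (Pi\<^sub>E I A)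
      = (\<Prod>i\<in>I. emeasure (\<mu> \<Otimes>\<^sub>M T) (A i))" .
  qed (use I in simp_all)
  have W_prob: "prob_space W" unfolding W_def by (rule W.prob_space_axioms)
  have marg: "distr W (\<mu> \<Otimes>\<^sub>M T) (Z i) = \<mu> \<Otimes>\<^sub>M T" if i: "i \<in> I" for i
  proof -
    have "distr W (\<mu> \<Otimes>\<^sub>M T) (Z i)
        = distr (distr W (\<Pi>\<^sub>M i\<in>I. \<mu> \<Otimes>\<^sub>M T) (\<lambda>z. \<lambda>i\<in>I. Z i z)) (\<mu> \<Otimes>\<^sub>M T) (\<lambda>f. f i)"
      using i by (subst distr_distr[OF _ Zv]) (auto simp: o_def)
    also have "\<dots> = \<mu> \<Otimes>\<^sub>M T" unfolding joint by (rule PP.PiM_component[OF i])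
    finally show ?thesis .
  qed
  have "prob_space.indep_vars W (\<lambda>_. \<mu> \<Otimes>\<^sub>M T) Z I"
  proof (subst prob_space.indep_vars_iff_distr_eq_PiM'[OF W_prob I(2) Z])
    show "distr W (\<Pi>\<^sub>M i\<in>I. \<mu> \<Otimes>\<^sub>M T) (\<lambda>z. \<lambda>i\<in>I. Z i z) = (\<Pi>\<^sub>M i\<in>I. distr W (\<mu> \<Otimes>\<^sub>M T) (Z i))"
      unfolding joint by (intro PiM_cong) (simp_all add: marg)
  qed
  then show "prob_space.indep_vars W (\<lambda>_. \<mu> \<Otimes>\<^sub>M T) (\<lambda>i z. (X i (fst z), snd z i)) I"
    by (simp add: Z_def[abs_def])
  show "distr W (\<mu> \<Otimes>\<^sub>M T) (\<lambda>z. (X i (fst z), snd z i)) = \<mu> \<Otimes>\<^sub>M T" if "i \<in> I" for i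
    using marg[OF that] by (simp add: Z_def[abs_def])
qed

text \<open>The step that removes the auxiliary randomness: some value is no worse than the average.\<close>

lemma exists_good_section:
  assumes M: "prob_space M" and T: "prob_space T"
    and k: "k \<in> borel_measurable (M \<Otimes>\<^sub>M T)" and le: "(\<integral>\<^sup>+ z. k z \<partial>(M \<Otimes>\<^sub>M T)) < (b :: ennreal)"
  obtains u where "u \<in> space T" "(\<integral>\<^sup>+ \<omega>. k (\<omega>, u) \<partial>M) < b"
proof (rule ccontr)
  assume "\<not> thesis"
  interpret M: prob_space M by fact
  interpret T: prob_space T by fact
  interpret pair_sigma_finite M T ..
  have "b = (\<integral>\<^sup>+ u. b \<partial>T)" using T.emeasure_space_1 by simp
  also have "\<dots> \<le> (\<integral>\<^sup>+ u. (\<integral>\<^sup>+ \<omega>. k (\<omega>, u) \<partial>M) \<partial>T)"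
  proof (intro nn_integral_mono)
    fix u assume "u \<in> space T"
    with that \<open>\<not> thesis\<close> show "b \<le> (\<integral>\<^sup>+ \<omega>. k (\<omega>, u) \<partial>M)" by (meson not_le)
  qed
  also have "\<dots> = (\<integral>\<^sup>+ z. k z \<partial>(M \<Otimes>\<^sub>M T))" using k by (rule nn_integral_snd)
  finally show False using le by simp
qed

lemma empirical_cong:
  assumes "\<And>i. i \<in> {1..n} \<Longrightarrow> y i = z i"
  shows "empirical n y = empirical n z"
  unfolding empirical_def using assms by (intro arg_cong[where f="measure_of UNIV (sets borel)"] ext) auto

lemma measurable_gen_sigma_component:
  assumes "1 \<le> k"
  shows "X k \<in> borel_measurable (gen_sigma M X k)"
proof -
  have "(\<lambda>\<omega>. \<lambda>i\<in>{1..k}. X i \<omega>) \<in> measurable (gen_sigma M X k) (Pi\<^sub>M {1..k} (\<lambda>_. borel))"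
    unfolding gen_sigma_def by (rule measurable_vimage_algebra1) (auto simp: space_PiM)
  moreover have "(\<lambda>f. f k) \<in> measurable (Pi\<^sub>M {1..k} (\<lambda>_. borel)) borel"
    using assms by (intro measurable_component_singleton) auto
  ultimately have "(\<lambda>\<omega>. (\<lambda>i\<in>{1..k}. X i \<omega>) k) \<in> borel_measurable (gen_sigma M X k)"
    by (rule measurable_compose)
  then show ?thesis using assms by simp
qed

text \<open>With \<open>\<nu>\<close> the second marginal, the loss \<open>B - payoff\<close> is at most \<open>k = (B - F \<nu> + \<epsilon>) + 2 B 1\<^bsub>Bad\<^esub> + C\<close>,
  where \<open>Bad\<close> is the event that the empirical measure of the controls is far from \<open>\<nu>\<close> and \<open>C\<close> is their mean cost. All
  three terms are nonnegative, so Tonelli's theorem applies to \<open>k\<close> and yields a good choice of the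
  auxiliary numbers.\<close>

lemma control_payoff_lower_bound:
  fixes p :: "('a::polish_space \<times> 'a) measure" and F :: "'a measure \<Rightarrow> real" and c :: "'a \<times> 'a \<Rightarrow> ennreal"
    and X :: "nat \<Rightarrow> 'b \<Rightarrow> 'a"
  assumes F: "continuous_map weak_topology euclideanreal F"
    and c: "c \<in> borel_measurable borel"
    and M: "prob_space M" and indep: "prob_space.indep_vars M (\<lambda>_. borel) X {1..}"
    and law: "\<And>i. 1 \<le> i \<Longrightarrow> distr M borel (X i) = distr p borel fst"
    and B: "\<And>\<nu>. \<nu> \<in> borel_probs \<Longrightarrow> \<bar>F \<nu>\<bar> \<le> B"
    and p: "p \<in> borel_probs" and cost: "(\<integral>\<^sup>+ z. c z \<partial>p) = ennreal I" "0 \<le> I"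
    and \<epsilon>: "0 < \<epsilon>"
  shows "eventually (\<lambda>n. \<exists>Y\<in>adapted_tuples M X n.
      ereal (F (distr p borel snd) - I - 3 * \<epsilon>) \<le> ereal_expectation M (\<lambda>\<omega>.
              ereal (F (empirical n (\<lambda>i. Y i \<omega>)))
              - enn2ereal (ennreal (1 / real n) * (\<Sum>i = 1..n. c (X i \<omega>, Y i \<omega>))))) sequentially"
proof -
  interpret M: prob_space M by fact
  have X: "X i \<in> borel_measurable M" if "1 \<le> i" for i
    using indep that unfolding M.indep_vars_def by auto
  define \<mu> where "\<mu> = distr p borel fst"
  define \<nu> where "\<nu> = distr p borel snd"
  have \<mu>: "\<mu> \<in> borel_probs" and \<nu>: "\<nu> \<in> borel_probs"
    unfolding \<mu>_def \<nu>_def using p by (auto intro!: distr_borel_probs simp: borel_prod[symmetric])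
  obtain U :: "nat \<Rightarrow> 'a set" where U: "\<And>i. open (U i)"
      "\<And>G. open G \<Longrightarrow> \<exists>k. incseq (\<lambda>j. U (k j)) \<and> (\<Union>j. U (k j)) = G"
    using countable_open_approximation by blast
  obtain m \<delta> where \<delta>: "0 < \<delta>" and key: "\<And>q. q \<in> borel_probs \<Longrightarrow>
      (\<And>i::nat. i < m \<Longrightarrow> measure \<nu> (U i) - \<delta> < measure q (U i)) \<Longrightarrow> F \<nu> - \<epsilon> \<le> F q"
    by (rule functional_lower_near_law[where U=U, OF \<nu> F _ _ \<epsilon>]) (assumption | rule U(1) | rule U(2), assumption | blast)+
  obtain \<phi> :: "'a \<times> real \<Rightarrow> 'a" where \<phi>: "\<phi> \<in> borel_measurable (borel \<Otimes>\<^sub>M borel)"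
    and \<phi>_law: "distr (\<mu> \<Otimes>\<^sub>M unif) borel (\<lambda>z. (fst z, \<phi> z)) = p"
    unfolding \<mu>_def by (rule randomisation[OF p])
  have s\<mu>: "sets (\<mu> \<Otimes>\<^sub>M unif) = sets (borel \<Otimes>\<^sub>M borel)"
    using borel_probsD[OF \<mu>] by (intro sets_pair_measure_cong) auto
  have \<phi>': "\<phi> \<in> borel_measurable (\<mu> \<Otimes>\<^sub>M unif)"
    using \<phi> s\<mu> by (simp cong: measurable_cong_sets)
  have \<phi>_pair: "(\<lambda>z. (fst z, \<phi> z)) \<in> measurable (\<mu> \<Otimes>\<^sub>M unif) borel"
  proof -
    have "(\<lambda>z. (fst z, \<phi> z)) \<in> measurable (borel \<Otimes>\<^sub>M borel) (borel \<Otimes>\<^sub>M borel)"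
      using \<phi> by measurable
    then show ?thesis using s\<mu> by (simp add: borel_prod cong: measurable_cong_sets)
  qed
  have B0: "0 \<le> B" using B[OF \<nu>] by linarith
  have "(\<lambda>n. 2 * B * (real m * (2 * exp (- 2 * real n * \<delta>\<^sup>2)))) \<longlonglongrightarrow> 2 * B * 0"
    by (intro tendsto_mult tendsto_const deviation_bound_tendsto_0 \<delta>)
  from order_tendstoD(2)[OF this, of \<epsilon>]
  have "eventually (\<lambda>n. 2 * B * (real m * (2 * exp (- 2 * real n * \<delta>\<^sup>2))) < \<epsilon>) sequentially"
    using \<epsilon> by simp
  then show ?thesis
    using eventually_ge_at_top[of 1]
  proof eventually_elim
    case (elim n)
    then have n: "1 \<le> n" by simp
    have ne: "{1..n} \<noteq> {}" using n by auto
    have indep_n: "M.indep_vars (\<lambda>_. borel) X {1..n}"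
      using indep by (rule M.indep_vars_subset) auto
    have law_n: "distr M borel (X i) = \<mu>" if "i \<in> {1..n}" for i
      using that law by (auto simp: \<mu>_def)
    define TI where "TI = (\<Pi>\<^sub>M i\<in>{1..n}. unif)"
    define W where "W = M \<Otimes>\<^sub>M TI"
    define Y where "Y i z = \<phi> (X i (fst z), snd z i)" for i and z :: "'b \<times> (nat \<Rightarrow> real)"
    have TI_prob: "prob_space TI" unfolding TI_def by (intro prob_space_PiM prob_space_unif)
    interpret TI: prob_space TI by (rule TI_prob)
    interpret W': pair_prob_space M TI ..
    have W_prob: "prob_space W" unfolding W_def by (rule W'.prob_space_axioms)
    interpret W: prob_space W by (rule W_prob)
    note pairs = indep_pairs_with_product[OF M prob_space_unif finite_atLeastAtMost ne indep_n law_n,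
        folded TI_def, folded W_def]
    have pair_indep: "W.indep_vars (\<lambda>_. \<mu> \<Otimes>\<^sub>M unif) (\<lambda>i z. (X i (fst z), snd z i)) {1..n}"
      by (rule pairs(1))
    have pair_law: "distr W (\<mu> \<Otimes>\<^sub>M unif) (\<lambda>z. (X i (fst z), snd z i)) = \<mu> \<Otimes>\<^sub>M unif" if "i \<in> {1..n}" for i
      by (rule pairs(2)[OF _ that])
    have Z: "(\<lambda>z. (X i (fst z), snd z i)) \<in> measurable W (\<mu> \<Otimes>\<^sub>M unif)" if "i \<in> {1..n}" for i
      using pair_indep that unfolding W.indep_vars_def by auto
    have Y_indep: "W.indep_vars (\<lambda>_. borel) Y {1..n}"
      unfolding Y_def[abs_def] using pair_indep \<phi>' by (rule W.indep_vars_compose2)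
    have XY_law: "distr W borel (\<lambda>z. (X i (fst z), Y i z)) = p"
      and XY_meas: "(\<lambda>z. (X i (fst z), Y i z)) \<in> measurable W borel" if i: "i \<in> {1..n}" for i
    proof -
      show "(\<lambda>z. (X i (fst z), Y i z)) \<in> measurable W borel"
        using measurable_compose[OF Z[OF i] \<phi>_pair] by (simp add: Y_def)
      have "distr (distr W (\<mu> \<Otimes>\<^sub>M unif) (\<lambda>z. (X i (fst z), snd z i))) borel (\<lambda>z. (fst z, \<phi> z))
          = distr W borel (\<lambda>z. (X i (fst z), Y i z))"
        by (subst distr_distr[OF \<phi>_pair Z[OF i]]) (simp add: o_def Y_def)
      then show "distr W borel (\<lambda>z. (X i (fst z), Y i z)) = p"
        by (simp only: pair_law[OF i] \<phi>_law)
    qed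
    have Y_law: "distr W borel (Y i) = \<nu>" if i: "i \<in> {1..n}" for i
    proof -
      have "snd \<in> borel_measurable (borel :: ('a \<times> 'a) measure)" by (simp add: borel_prod[symmetric])
      then have "distr (distr W borel (\<lambda>z. (X i (fst z), Y i z))) borel snd = distr W borel (Y i)"
        by (subst distr_distr[OF _ XY_meas[OF i]]) (auto simp: o_def)
      then show ?thesis by (simp only: XY_law[OF i] \<nu>_def)
    qed
    have Ub: "U i \<in> sets borel" for i using U(1) by simp
    define Bad where "Bad = {z \<in> space W. \<exists>i<m. \<delta> \<le> \<bar>measure (empirical n (\<lambda>i. Y i z)) (U i) - measure \<nu> (U i)\<bar>}"
    have Bad: "Bad \<in> sets W" "measure W Bad \<le> real m * (2 * exp (- 2 * real n * \<delta>\<^sup>2))"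
      unfolding Bad_def
      by (rule empirical_deviation_finite[where U=U]; fact W_prob Y_indep Y_law n Ub \<delta>)+
    define C where "C z = ennreal (1 / real n) * (\<Sum>i = 1..n. c (X i (fst z), Y i z))" for z
    have c_meas: "(\<lambda>z. c (X i (fst z), Y i z)) \<in> borel_measurable W" if "i \<in> {1..n}" for i
      using XY_meas[OF that] c by (rule measurable_compose)
    have C_meas: "C \<in> borel_measurable W"
      unfolding C_def[abs_def] using c_meas by (intro borel_measurable_times_ennreal borel_measurable_const borel_measurable_sum)
    have C_int: "(\<integral>\<^sup>+ z. C z \<partial>W) = ennreal I"
    proof -
      have "(\<integral>\<^sup>+ z. C z \<partial>W) = ennreal (1 / real n) * (\<Sum>i = 1..n. \<integral>\<^sup>+ z. c (X i (fst z), Y i z) \<partial>W)"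
        unfolding C_def
        by (simp only: nn_integral_cmult nn_integral_sum borel_measurable_sum c_meas)
      also have "(\<Sum>i = 1..n. \<integral>\<^sup>+ z. c (X i (fst z), Y i z) \<partial>W) = (\<Sum>i = 1..n. ennreal I)"
      proof (rule sum.cong[OF refl])
        fix i assume i: "i \<in> {1..n}"
        have "(\<integral>\<^sup>+ z. c (X i (fst z), Y i z) \<partial>W) = (\<integral>\<^sup>+ z. c z \<partial>distr W borel (\<lambda>z. (X i (fst z), Y i z)))"
          using XY_meas[OF i] c by (subst nn_integral_distr) auto
        then show "(\<integral>\<^sup>+ z. c (X i (fst z), Y i z) \<partial>W) = ennreal I"
          by (simp only: XY_law[OF i] cost)
      qed
      also have "ennreal (1 / real n) * (\<Sum>i = 1..n. ennreal I) = ennreal I"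
        using n cost(2) by (simp add: ennreal_of_nat_eq_real_of_nat ennreal_mult[symmetric])
      finally show ?thesis .
    qed
    define a where "a = B - F \<nu> + \<epsilon>"
    have a0: "0 \<le> a" using B[OF \<nu>] \<epsilon> by (simp add: a_def)
    define k where "k z = ennreal a + ennreal (2 * B) * indicator Bad z + C z" for z
    have k_meas: "k \<in> borel_measurable (M \<Otimes>\<^sub>M TI)"
      unfolding k_def[abs_def] W_def[symmetric] using C_meas Bad(1) by measurable
    have "(\<integral>\<^sup>+ z. k z \<partial>(M \<Otimes>\<^sub>M TI)) = ennreal a + ennreal (2 * B) * emeasure W Bad + ennreal I"
      unfolding k_def W_def[symmetric] using C_meas Bad(1) W.emeasure_space_1
      by (simp add: nn_integral_add nn_integral_cmult C_int)
    also have "\<dots> = ennreal (a + 2 * B * measure W Bad + I)"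
      using a0 B0 cost(2) by (simp add: W.emeasure_eq_measure ennreal_mult ennreal_plus)
    also have "\<dots> < ennreal (a + 2 * \<epsilon> + I)"
    proof (rule ennreal_lessI)
      have "2 * B * measure W Bad \<le> 2 * B * (real m * (2 * exp (- 2 * real n * \<delta>\<^sup>2)))"
        using B0 Bad(2) by (intro mult_left_mono) auto
      with elim(1) \<epsilon> show "a + 2 * B * measure W Bad + I < a + 2 * \<epsilon> + I" by linarith
      show "0 < a + 2 * \<epsilon> + I" using a0 \<epsilon> cost(2) by linarith
    qed
    finally obtain u where u: "u \<in> space TI" "(\<integral>\<^sup>+ \<omega>. k (\<omega>, u) \<partial>M) < ennreal (a + 2 * \<epsilon> + I)"
      by (rule exists_good_section[OF M TI_prob k_meas])
    define V where "V = (\<lambda>i\<in>{1..n}. \<lambda>\<omega>. \<phi> (X i \<omega>, u i))"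
    have V_eq: "V i \<omega> = Y i (\<omega>, u)" if "i \<in> {1..n}" for i \<omega>
      using that by (simp add: V_def Y_def)
    show ?case
    proof
      show "V \<in> adapted_tuples M X n"
        unfolding adapted_tuples_def V_def
      proof (rule restrict_PiE_iff[THEN iffD2], rule ballI)
        fix i assume i: "i \<in> {1..n}"
        have "X i \<in> borel_measurable (gen_sigma M X i)"
          using i by (intro measurable_gen_sigma_component) auto
        then have "(\<lambda>\<omega>. (X i \<omega>, u i)) \<in> measurable (gen_sigma M X i) (borel \<Otimes>\<^sub>M borel)"
          by measurable
        then show "(\<lambda>\<omega>. \<phi> (X i \<omega>, u i)) \<in> borel_measurable (gen_sigma M X i)"
          using \<phi> by (rule measurable_compose)
      qed
      let ?G = "\<lambda>\<omega>. ereal (F (empirical n (\<lambda>i. V i \<omega>)))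
              - enn2ereal (ennreal (1 / real n) * (\<Sum>i = 1..n. c (X i \<omega>, V i \<omega>)))"
      have L_eq: "empirical n (\<lambda>i. V i \<omega>) = empirical n (\<lambda>i. Y i (\<omega>, u))" for \<omega>
        by (rule empirical_cong) (rule V_eq)
      have C_eq: "ennreal (1 / real n) * (\<Sum>i = 1..n. c (X i \<omega>, V i \<omega>)) = C (\<omega>, u)" for \<omega>
        unfolding C_def by (intro arg_cong2[where f="(*)"] refl sum.cong) (auto simp: V_eq)
      have G: "ereal B - enn2ereal (k (\<omega>, u)) \<le> ?G \<omega>" if \<omega>: "\<omega> \<in> space M" for \<omega>
      proof (cases "C (\<omega>, u)")
        case (real x)
        define b where "b = (if (\<omega>, u) \<in> Bad then 2 * B else 0)"
        have in_W: "(\<omega>, u) \<in> space W" using \<omega> u by (simp add: W_def space_pair_measure)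
        have "k (\<omega>, u) = ennreal (a + b + x)"
          using real a0 B0 by (auto simp: k_def b_def ennreal_plus)
        moreover have "B - (a + b) \<le> F (empirical n (\<lambda>i. Y i (\<omega>, u)))"
        proof (cases "(\<omega>, u) \<in> Bad")
          case True
          then show ?thesis
            using B[OF empirical_in_borel_probs[OF n], of "\<lambda>i. Y i (\<omega>, u)"] a0 by (simp add: b_def)
        next
          case False
          have "F \<nu> - \<epsilon> \<le> F (empirical n (\<lambda>i. Y i (\<omega>, u)))"
          proof (rule key)
            show "empirical n (\<lambda>i. Y i (\<omega>, u)) \<in> borel_probs" using n by (rule empirical_in_borel_probs)
            fix i assume "i < m"
            then have "\<not> \<delta> \<le> \<bar>measure (empirical n (\<lambda>i. Y i (\<omega>, u))) (U i) - measure \<nu> (U i)\<bar>"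
              using False in_W unfolding Bad_def by blast
            then show "measure \<nu> (U i) - \<delta> < measure (empirical n (\<lambda>i. Y i (\<omega>, u))) (U i)" by linarith
          qed
          then show ?thesis using False by (simp add: a_def b_def)
        qed
        moreover have "0 \<le> b" using B0 by (simp add: b_def)
        ultimately have "enn2ereal (k (\<omega>, u)) = ereal (a + b + x)"
            and "B - (a + b + x) \<le> F (empirical n (\<lambda>i. Y i (\<omega>, u))) - x"
          using real a0 by (simp_all only: enn2ereal_ennreal add_nonneg_nonneg)
        moreover have "enn2ereal (C (\<omega>, u)) = ereal x"
          using real by (simp add: enn2ereal_ennreal)
        ultimately show ?thesis
          unfolding L_eq C_eq by simp
      next
        case top
        then show ?thesis by (simp add: k_def)
      qed
      have ku_meas: "(\<lambda>\<omega>. k (\<omega>, u)) \<in> borel_measurable M"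
        using measurable_compose[OF measurable_Pair2'[OF u(1)] k_meas] .
      obtain y where y: "(\<integral>\<^sup>+ \<omega>. k (\<omega>, u) \<partial>M) = ennreal y" "0 \<le> y" "y < a + 2 * \<epsilon> + I"
        using u(2) by (cases "\<integral>\<^sup>+ \<omega>. k (\<omega>, u) \<partial>M") (auto simp: ennreal_less_iff)
      have "ereal (F (distr p borel snd) - I - 3 * \<epsilon>) \<le> ereal B - enn2ereal (\<integral>\<^sup>+ \<omega>. k (\<omega>, u) \<partial>M)"
        using y by (simp add: a_def \<nu>_def enn2ereal_ennreal)
      also have "\<dots> = ereal_expectation M (\<lambda>\<omega>. ereal B - enn2ereal (k (\<omega>, u)))"
        by (rule ereal_expectation_const_minus[symmetric, OF M ku_meas]) (simp add: y)
      also have "\<dots> \<le> ereal_expectation M ?G"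
        by (rule ereal_expectation_mono) (use G in auto)
      finally show "ereal (F (distr p borel snd) - I - 3 * \<epsilon>) \<le> ereal_expectation M ?G" .
    qed
  qed
qed

section \<open>The limit\<close>

text \<open>The second marginal of a Borel probability measure is again one, so it imposes no condition.\<close>

lemma UN_couplings:
  "(\<Union>\<nu>\<in>borel_probs. couplings \<mu> \<nu>)
    = {p \<in> borel_probs. distr p borel fst = (\<mu> :: 'a::second_countable_topology measure)}"
  by (auto simp: couplings_def borel_prod[symmetric] intro!: distr_borel_probs)

text \<open>The infimum defining the transport cost need not be attained and may range over the empty set, hence the
  comparison with all \<open>t\<close> strictly below the left side.\<close>

lemma SUP_transport_cost:
  fixes \<mu> :: "'a::second_countable_topology measure"
  shows "(SUP \<nu>\<in>borel_probs. ereal (F \<nu>) - enn2ereal (transport_cost c \<mu> \<nu>))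
    = (SUP \<pi>\<in>(\<Union>\<nu>\<in>borel_probs. couplings \<mu> \<nu>). ereal (F (distr \<pi> borel snd)) - enn2ereal (\<integral>\<^sup>+ p. c p \<partial>\<pi>))"
    (is "?L = ?R")
proof (rule antisym)
  show "?L \<le> ?R"
  proof (rule SUP_least, rule dense_le)
    fix \<nu> t assume \<nu>: "\<nu> \<in> borel_probs" and t: "t < ereal (F \<nu>) - enn2ereal (transport_cost c \<mu> \<nu>)"
    show "t \<le> ?R"
    proof (cases t)
      case (real x)
      with t obtain y where y: "0 \<le> y" "transport_cost c \<mu> \<nu> = ennreal y" "x < F \<nu> - y"
        by (auto simp: ereal_minus_enn2ereal_less_iff)
      then have "(INF \<pi>\<in>couplings \<mu> \<nu>. \<integral>\<^sup>+ p. c p \<partial>\<pi>) < ennreal (F \<nu> - x)"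
        unfolding transport_cost_def[symmetric] by (simp add: ennreal_less_iff)
      then obtain \<pi> where \<pi>: "\<pi> \<in> couplings \<mu> \<nu>" and less: "(\<integral>\<^sup>+ p. c p \<partial>\<pi>) < ennreal (F \<nu> - x)"
        unfolding INF_less_iff by blast
      obtain w where w: "(\<integral>\<^sup>+ p. c p \<partial>\<pi>) = ennreal w" "0 \<le> w" "w < F \<nu> - x"
        using less by (cases "\<integral>\<^sup>+ p. c p \<partial>\<pi>") (auto simp: ennreal_less_iff)
      have "t \<le> ereal (F (distr \<pi> borel snd)) - enn2ereal (\<integral>\<^sup>+ p. c p \<partial>\<pi>)"
        using \<pi> w real by (simp add: couplings_def enn2ereal_ennreal)
      also have "\<dots> \<le> ?R" using \<pi> \<nu> by (intro SUP_upper) auto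
      finally show ?thesis .
    qed (use t in auto)
  qed
  show "?R \<le> ?L"
  proof (rule SUP_least)
    fix \<pi> assume "\<pi> \<in> (\<Union>\<nu>\<in>borel_probs. couplings \<mu> \<nu>)"
    then obtain \<nu> where \<nu>: "\<nu> \<in> borel_probs" and \<pi>: "\<pi> \<in> couplings \<mu> \<nu>" by blast
    have "transport_cost c \<mu> \<nu> \<le> (\<integral>\<^sup>+ p. c p \<partial>\<pi>)"
      unfolding transport_cost_def using \<pi> by (rule INF_lower)
    then have "ereal (F (distr \<pi> borel snd)) - enn2ereal (\<integral>\<^sup>+ p. c p \<partial>\<pi>)
        \<le> ereal (F \<nu>) - enn2ereal (transport_cost c \<mu> \<nu>)"
      using \<pi> by (intro ereal_minus_mono) (auto simp: couplings_def less_eq_ennreal.rep_eq)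
    also have "\<dots> \<le> ?L" using \<nu> by (rule SUP_upper)
    finally show "ereal (F (distr \<pi> borel snd)) - enn2ereal (\<integral>\<^sup>+ p. c p \<partial>\<pi>) \<le> ?L" .
  qed
qed

theorem corollary1p7:
  fixes \<mu> :: "'a::polish_space measure"
    and c :: "'a \<times> 'a \<Rightarrow> ennreal"
    and M :: "'b measure"
    and X :: "nat \<Rightarrow> 'b \<Rightarrow> 'a"
    and F :: "'a measure \<Rightarrow> real"
  assumes "\<mu> \<in> borel_probs"
    and "lower_semicontinuous c"
    and "\<exists>p. c p \<noteq> \<infinity>"
    and "(\<integral>\<^sup>+ x. c (x, x) \<partial>\<mu>) < \<infinity>"
    and "\<And>(K :: 'a set) (m :: real). compact K \<Longrightarrow> 0 \<le> m \<Longrightarrow>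
           compact (closure {y. (INF x\<in>K. c (x, y)) \<le> ennreal m})"
    and "prob_space M"
    and "prob_space.indep_vars M (\<lambda>_. borel) X {1..}"
    and "\<And>i. 1 \<le> i \<Longrightarrow> distr M borel (X i) = \<mu>"
    and "continuous_map weak_topology euclideanreal F"
    and "bounded (F ` borel_probs)"
  shows "(\<lambda>n. SUP Y\<in>adapted_tuples M X n.
            ereal_expectation M (\<lambda>\<omega>.
              ereal (F (empirical n (\<lambda>i. Y i \<omega>)))
              - enn2ereal (ennreal (1 / real n) * (\<Sum>i = 1..n. c (X i \<omega>, Y i \<omega>)))))
         \<longlonglongrightarrow> (SUP \<nu>\<in>borel_probs. ereal (F \<nu>) - enn2ereal (transport_cost c \<mu> \<nu>))
       \<and> (SUP \<nu>\<in>borel_probs. ereal (F \<nu>) - enn2ereal (transport_cost c \<mu> \<nu>))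
         = (SUP \<pi>\<in>(\<Union>\<nu>\<in>borel_probs. couplings \<mu> \<nu>).
              ereal (F (distr \<pi> borel snd)) - enn2ereal (\<integral>\<^sup>+ p. c p \<partial>\<pi>))"
proof -
  let ?E = "\<lambda>n Y. ereal_expectation M (\<lambda>\<omega>.
              ereal (F (empirical n (\<lambda>i. Y i \<omega>)))
              - enn2ereal (ennreal (1 / real n) * (\<Sum>i = 1..n. c (X i \<omega>, Y i \<omega>))))"
  let ?V = "\<lambda>n. SUP Y\<in>adapted_tuples M X n. ?E n Y"
  define payoff where "payoff p = ereal (F (distr p borel snd)) - enn2ereal (\<integral>\<^sup>+ z. c z \<partial>p)" for p
  define Q :: "('a \<times> 'a) measure set" where "Q = {p \<in> borel_probs. distr p borel fst = \<mu>}"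
  have c_meas: "c \<in> borel_measurable borel"
    using assms(2) by (rule lower_semicontinuous_measurable)
  obtain B where B: "\<And>\<nu>. \<nu> \<in> borel_probs \<Longrightarrow> \<bar>F \<nu>\<bar> \<le> B"
    using assms(10) unfolding bounded_iff by auto
  have payoff_le: "payoff p \<le> ereal B" if "p \<in> Q" for p
  proof -
    have "distr p borel snd \<in> borel_probs"
      using that by (auto simp: Q_def borel_prod[symmetric] intro!: distr_borel_probs)
    from B[OF this] show ?thesis
      unfolding payoff_def by (cases "\<integral>\<^sup>+ z. c z \<partial>p") (auto simp: enn2ereal_ennreal)
  qed
  have diag: "(\<lambda>x. (x, x)) \<in> borel_measurable (borel :: 'a measure)"
    by (simp add: borel_prod[symmetric])
  have diag_\<mu>: "(\<lambda>x. (x, x)) \<in> measurable \<mu> borel"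
    using diag borel_probsD(2)[OF assms(1)] by (simp cong: measurable_cong_sets)
  \<comment> \<open>the diagonal coupling has finite cost, so \<open>S\<close> is not \<open>-\<infinity>\<close>\<close>
  define p0 where "p0 = distr \<mu> borel (\<lambda>x. (x, x))"
  have "distr p0 borel fst = distr \<mu> borel (\<lambda>x. x)"
    unfolding p0_def by (subst distr_distr[OF _ diag_\<mu>]) (auto simp: o_def borel_prod[symmetric])
  also have "\<dots> = \<mu>" using borel_probsD(2)[OF assms(1)] by (intro distr_id2) simp
  finally have p0: "p0 \<in> Q"
    unfolding Q_def p0_def using assms(1) diag by (auto intro: distr_borel_probs)
  have "(\<integral>\<^sup>+ z. c z \<partial>p0) < \<infinity>"
    unfolding p0_def using assms(4) c_meas diag_\<mu> by (simp add: nn_integral_distr)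
  then have payoff_p0: "- \<infinity> < payoff p0"
    unfolding payoff_def by (cases "\<integral>\<^sup>+ z. c z \<partial>p0") (auto simp: enn2ereal_ennreal)
  have "(SUP p\<in>Q. payoff p) \<le> ereal B" by (rule SUP_least) (rule payoff_le)
  moreover have "- \<infinity> < (SUP p\<in>Q. payoff p)" using payoff_p0 SUP_upper[OF p0, of "payoff"] by (rule less_le_trans)
  ultimately obtain S where S: "(SUP p\<in>Q. payoff p) = ereal S"
    by (cases "SUP p\<in>Q. payoff p") auto
  have "?V \<longlonglongrightarrow> ereal S"
  proof (rule order_tendstoI)
    fix a assume "a < ereal S"
    then obtain p where p: "p \<in> Q" "a < payoff p"
      unfolding S[symmetric] less_SUP_iff by blast
    obtain I where I: "(\<integral>\<^sup>+ z. c z \<partial>p) = ennreal I" "0 \<le> I"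
      using p(2) unfolding payoff_def by (cases "\<integral>\<^sup>+ z. c z \<partial>p") auto
    have payoff_p: "payoff p = ereal (F (distr p borel snd) - I)"
      unfolding payoff_def using I by (simp add: enn2ereal_ennreal)
    obtain \<epsilon> where \<epsilon>: "0 < \<epsilon>" "a < ereal (F (distr p borel snd) - I - 3 * \<epsilon>)"
    proof (cases a)
      case (real x)
      then show ?thesis
        using p(2) payoff_p by (intro that[of "(F (distr p borel snd) - I - x) / 6"]) (auto simp: field_simps)
    next
      case MInf
      then show ?thesis by (intro that[of 1]) auto
    qed (use p(2) in auto)
    have law: "distr M borel (X i) = distr p borel fst" if "1 \<le> i" for i
      using p(1) assms(8)[OF that] by (simp add: Q_def)
    have "p \<in> borel_probs" using p(1) by (simp add: Q_def)
    have "eventually (\<lambda>n. \<exists>Y\<in>adapted_tuples M X n.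
        ereal (F (distr p borel snd) - I - 3 * \<epsilon>) \<le> ?E n Y) sequentially"
      by (rule control_payoff_lower_bound[OF assms(9) c_meas assms(6,7) law B \<open>p \<in> borel_probs\<close> I \<epsilon>(1)])
    then show "eventually (\<lambda>n. a < ?V n) sequentially"
    proof eventually_elim
      case (elim n)
      with \<epsilon>(2) show ?case unfolding less_SUP_iff by (blast intro: less_le_trans)
    qed
  next
    fix a assume a: "ereal S < a"
    obtain \<epsilon> where \<epsilon>: "0 < \<epsilon>" "ereal (S + 2 * \<epsilon>) < a"
    proof (cases a)
      case (real x)
      then show ?thesis using a by (intro that[of "(x - S) / 4"]) (auto simp: field_simps)
    next
      case PInf
      then show ?thesis by (intro that[of 1]) auto
    qed (use a in auto)
    have F_le: "F \<nu> \<le> B" if "\<nu> \<in> borel_probs" for \<nu> using B[OF that] by linarith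
    have le_S: "ereal (F (distr p borel snd)) - enn2ereal (\<integral>\<^sup>+ z. c z \<partial>p) \<le> ereal S"
      if "p \<in> borel_probs" "distr p borel fst = \<mu>" for p
      unfolding S[symmetric] payoff_def using that by (intro SUP_upper) (simp add: Q_def)
    have "eventually (\<lambda>n. \<forall>Y. ?E n Y \<le> ereal (S + 2 * \<epsilon>)) sequentially"
      by (rule control_payoff_upper_bound[OF assms(1,9,2,5,6,7,8) F_le le_S \<epsilon>(1)])
    then show "eventually (\<lambda>n. ?V n < a) sequentially"
    proof eventually_elim
      case (elim n)
      then have "?V n \<le> ereal (S + 2 * \<epsilon>)" by (intro SUP_least) blast
      also note \<epsilon>(2)
      finally show ?case .
    qed
  qed
  moreover have "ereal S = (SUP \<pi>\<in>(\<Union>\<nu>\<in>borel_probs. couplings \<mu> \<nu>).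
              ereal (F (distr \<pi> borel snd)) - enn2ereal (\<integral>\<^sup>+ p. c p \<partial>\<pi>))"
    unfolding UN_couplings S[symmetric] Q_def payoff_def ..
  ultimately show ?thesis by (simp only: SUP_transport_cost simp_thms)
qed

end
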